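(* Let $\mathbb{K}$ be an algebraically closed field with $\mathrm{char}(\mathbb{K}) = 3$, let $n \geq 3$ be an integer, and let $X := \nu_2(\mathbb{P}^n) \subset \mathbb{P}^r$, $r = \binom{n+2}{2}-1$, be the second Veronese embedding of $\mathbb{P}^n$. Let $\Phi_3(X) \subset \mathbb{P}(I(X)_2)$ be the set of all rank $3$ quadrics in $\mathbb{P}(I(X)_2)$ and let $\langle \Phi_3(X) \rangle$ be its linear span in $\mathbb{P}(I(X)_2)$. Then $$\operatorname{codim}\big( \langle \Phi_3(X) \rangle, \mathbb{P}(I(X)_2) \big) = \binom{n+1}{4}.$$
   Context: $I(X)_2$ denotes the $\mathbb{K}$-vector space of quadratic forms on $\mathbb{P}^r$ vanishing on $X$, and $\mathbb{P}(I(X)_2)$ is the projective space of one-dimensional subspaces of $I(X)_2$. The rank of a quadratic form is the rank of its associated symmetric matrix. The codimension of a linear subspace $\mathbb{P}(W) \subset \mathbb{P}(V)$ is $\dim_{\mathbb{K}} V - \dim_{\mathbb{K}} W$. *)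

theory Defs
  imports
    "HOL-Library.Poly_Mapping"
    "HOL-Computational_Algebra.Polynomial"
    "Jordan_Normal_Form.DL_Rank"
begin

section \<open>Finitely supported functions as a vector space\<close>

text \<open>
  Finitely supported functions serve twice: with indices of type \<^typ>\<open>nat\<close> for the coordinate vectors
  of \<open>K\<^sup>N\<close> (supported on \<open>{..<N}\<close>), and with monomials as indices for polynomials.
\<close>

definition pscale :: "'a::field \<Rightarrow> ('b \<Rightarrow>\<^sub>0 'a) \<Rightarrow> ('b \<Rightarrow>\<^sub>0 'a)" where
  "pscale c p = Poly_Mapping.map ((*) c) p"

lemma lookup_pscale [simp]: "Poly_Mapping.lookup (pscale c p) k = c * Poly_Mapping.lookup p k"
  by (simp add: pscale_def map.rep_eq when_def)

global_interpretation pm: vector_space "pscale :: 'a::field \<Rightarrow> ('b \<Rightarrow>\<^sub>0 'a) \<Rightarrow> ('b \<Rightarrow>\<^sub>0 'a)"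
  by unfold_locales (auto intro!: poly_mapping_eqI simp: lookup_add algebra_simps)

definition coord_space :: "nat \<Rightarrow> (nat \<Rightarrow>\<^sub>0 'a::field) set" where
  "coord_space N = {x. Poly_Mapping.keys x \<subseteq> {..<N}}"


section \<open>Projective spaces and their linear subspaces\<close>

definition proj :: "('b \<Rightarrow>\<^sub>0 'a::field) set \<Rightarrow> ('b \<Rightarrow>\<^sub>0 'a) set set" where
  "proj V = {L. pm.subspace L \<and> L \<subseteq> V \<and> pm.dim L = 1}"

text \<open>The smallest \<open>\<P>(W)\<close> that contains the given set of points.\<close>

definition proj_span :: "('b \<Rightarrow>\<^sub>0 'a::field) set set \<Rightarrow> ('b \<Rightarrow>\<^sub>0 'a) set set" where
  "proj_span S = proj (pm.span (\<Union>S))"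

text \<open>
  For a subspace \<open>V\<close>, the space \<open>V\<close> is recovered from the set of points \<open>\<P>(V)\<close> as the
  span of their union (lemma \<open>span_Union_proj\<close> below). Hence the codimension of \<open>\<P>(W)\<close> in \<open>\<P>(V)\<close>
  is \<open>dim V - dim W\<close> (lemma \<open>proj_codim_proj\<close>), also when \<open>W = 0\<close> and \<open>\<P>(W)\<close> is empty.
\<close>

definition proj_codim :: "('b \<Rightarrow>\<^sub>0 'a::field) set set \<Rightarrow> ('b \<Rightarrow>\<^sub>0 'a) set set \<Rightarrow> int" where
  "proj_codim A B = int (pm.dim (pm.span (\<Union>B))) - int (pm.dim (pm.span (\<Union>A)))"

lemma span_Union_proj:
  assumes "pm.subspace V"
  shows "pm.span (\<Union>(proj V)) = V"
proof
  show "pm.span (\<Union>(proj V)) \<subseteq> V"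
    by (rule pm.span_minimal) (auto simp: proj_def assms)
  show "V \<subseteq> pm.span (\<Union>(proj V))"
  proof
    fix v assume v: "v \<in> V"
    show "v \<in> pm.span (\<Union>(proj V))"
    proof (cases "v = 0")
      case True
      then show ?thesis by (simp add: pm.span_zero)
    next
      case False
      then have "pm.independent {v}"
        by (simp add: pm.dependent_single)
      then have "pm.dim (pm.span {v}) = 1"
        using pm.dim_span_eq_card_independent by fastforce
      moreover have "pm.span {v} \<subseteq> V"
        using v by (intro pm.span_minimal assms) auto
      ultimately have "pm.span {v} \<in> proj V"
        by (simp add: proj_def)
      moreover have "v \<in> pm.span {v}"
        by (simp add: pm.span_base)
      ultimately show ?thesis
        by (meson UnionI pm.span_base)
    qed
  qed
qed

lemma proj_codim_proj:
  assumes "pm.subspace W" "pm.subspace V"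
  shows "proj_codim (proj W) (proj V) = int (pm.dim V) - int (pm.dim W)"
  by (simp only: proj_codim_def span_Union_proj[OF assms(1)] span_Union_proj[OF assms(2)])


section \<open>Quadratic forms\<close>

text \<open>A monomial is its exponent vector, a polynomial is the finitely supported function of its coefficients.\<close>

type_synonym monomial = "nat \<Rightarrow>\<^sub>0 nat"
type_synonym 'a mpoly = "monomial \<Rightarrow>\<^sub>0 'a"

definition mon_degree :: "monomial \<Rightarrow> nat" where
  "mon_degree m = (\<Sum>i\<in>Poly_Mapping.keys m. Poly_Mapping.lookup m i)"

definition eval_poly :: "'a::field mpoly \<Rightarrow> (nat \<Rightarrow>\<^sub>0 'a) \<Rightarrow> 'a" where
  "eval_poly p z = (\<Sum>m\<in>Poly_Mapping.keys p. Poly_Mapping.lookup p m *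
     (\<Prod>i\<in>Poly_Mapping.keys m. Poly_Mapping.lookup z i ^ Poly_Mapping.lookup m i))"

text \<open>Quadratic forms on \<open>\<P>\<^sup>r\<close>, in the coordinates \<open>z\<^sub>0, \<dots>, z\<^sub>r\<close>.\<close>

definition quadratic_forms :: "nat \<Rightarrow> 'a::field mpoly set" where
  "quadratic_forms r =
     {Q. \<forall>m\<in>Poly_Mapping.keys Q. Poly_Mapping.keys m \<subseteq> {..r} \<and> mon_degree m = 2}"

text \<open>
  The symmetric matrix \<open>A\<close> with \<open>Q(z) = \<Sum>\<^sub>i\<^sub>j A\<^sub>i\<^sub>j z\<^sub>i z\<^sub>j\<close>; the division by 2 presupposes that the
  characteristic is not 2.
\<close>

definition sym_matrix :: "nat \<Rightarrow> 'a::field mpoly \<Rightarrow> 'a mat" where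
  "sym_matrix r Q = mat (r + 1) (r + 1) (\<lambda>(i, j).
     let c = Poly_Mapping.lookup Q (Poly_Mapping.single i 1 + Poly_Mapping.single j 1)
     in if i = j then c else c / 2)"

definition quadric_rank :: "nat \<Rightarrow> 'a::field mpoly \<Rightarrow> nat" where
  "quadric_rank r Q = vec_space.rank (r + 1) (sym_matrix r Q)"

text \<open>\<open>I(X)\<^sub>2\<close> for a set \<open>X\<close> of points of \<open>\<P>\<^sup>r\<close>.\<close>

definition ideal2 :: "nat \<Rightarrow> (nat \<Rightarrow>\<^sub>0 'a::field) set set \<Rightarrow> 'a mpoly set" where
  "ideal2 r X = {Q \<in> quadratic_forms r. \<forall>L\<in>X. \<forall>z\<in>L. eval_poly Q z = 0}"

lemma subspace_ideal2: "pm.subspace (ideal2 r X)"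
proof -
  have ev: "eval_poly p z = (\<Sum>m\<in>S. Poly_Mapping.lookup p m *
     (\<Prod>i\<in>Poly_Mapping.keys m. Poly_Mapping.lookup z i ^ Poly_Mapping.lookup m i))"
    if "finite S" "Poly_Mapping.keys p \<subseteq> S" for S and p :: "'a mpoly" and z
    unfolding eval_poly_def using that
    by (intro sum.mono_neutral_left) (auto simp: in_keys_iff)
  have add: "eval_poly (p + q) z = eval_poly p z + eval_poly q z" for p q :: "'a mpoly" and z
  proof -
    let ?S = "Poly_Mapping.keys p \<union> Poly_Mapping.keys q"
    have "finite ?S" "Poly_Mapping.keys (p + q) \<subseteq> ?S"
      by (auto dest: Poly_Mapping.keys_add[THEN subsetD])
    then show ?thesis
      by (subst (1 2 3) ev[of ?S]) (auto simp: lookup_add sum.distrib distrib_right)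
  qed
  have keys: "Poly_Mapping.keys (pscale c p) \<subseteq> Poly_Mapping.keys p" for c :: 'a and p :: "'a mpoly"
    by (auto simp: in_keys_iff)
  have scale: "eval_poly (pscale c p) z = c * eval_poly p z" for c and p :: "'a mpoly" and z
    by (subst (1 2) ev[of "Poly_Mapping.keys p"])
       (use keys in \<open>auto simp: sum_distrib_left mult.assoc\<close>)
  have "eval_poly (0 :: 'a mpoly) z = 0" for z
    by (simp add: eval_poly_def)
  then show ?thesis
    unfolding pm.subspace_def ideal2_def quadratic_forms_def
    by (auto simp: add scale dest!: Poly_Mapping.keys_add[THEN subsetD] keys[THEN subsetD])
qed

text \<open>The points \<open>[Q]\<close> of \<open>\<P>(I(X)\<^sub>2)\<close> with \<open>Q\<close> of rank \<open>d\<close>.\<close>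

definition rank_quadrics :: "nat \<Rightarrow> nat \<Rightarrow> (nat \<Rightarrow>\<^sub>0 'a::field) set set \<Rightarrow> 'a mpoly set set" where
  "rank_quadrics d r X =
     {L \<in> proj (ideal2 r X). \<exists>Q. L = pm.span {Q} \<and> quadric_rank r Q = d}"


section \<open>The second Veronese embedding\<close>

text \<open>
  The monomials \<open>x\<^sub>i x\<^sub>j\<close> with \<open>i \<le> j \<le> n\<close>, listed lexicographically; the \<open>k\<close>-th one gives the \<open>k\<close>-th
  coordinate on the target space.
\<close>

definition index_pairs :: "nat \<Rightarrow> (nat \<times> nat) list" where
  "index_pairs n = [(i, j). i \<leftarrow> [0..<n + 1], j \<leftarrow> [i..<n + 1]]"

lemma length_index_pairs: "length (index_pairs n) = (n + 2) choose 2"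
proof -
  have "length (index_pairs n) = (\<Sum>i<n + 1. n + 1 - i)"
    by (simp add: index_pairs_def length_concat comp_def sum_list_distinct_conv_sum_set lessThan_atLeast0 del: upt_Suc)
  also have "\<dots> = (\<Sum>i<n + 1. Suc i)"
    by (rule sum.nat_diff_reindex[symmetric, THEN trans]) (auto intro!: sum.cong)
  also have "\<dots> = (n + 2) choose 2"
    by (induction n) (auto simp: numeral_2_eq_2)
  finally show ?thesis .
qed

definition veronese_vec :: "nat \<Rightarrow> (nat \<Rightarrow>\<^sub>0 'a::field) \<Rightarrow> (nat \<Rightarrow>\<^sub>0 'a)" where
  "veronese_vec n x = (\<Sum>k<length (index_pairs n).
     case index_pairs n ! k of (i, j) \<Rightarrow>
       Poly_Mapping.single k (Poly_Mapping.lookup x i * Poly_Mapping.lookup x j))"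

text \<open>On points, \<open>\<nu>\<^sub>2([x]) = [\<nu>\<^sub>2(x)]\<close>.\<close>

definition veronese :: "nat \<Rightarrow> (nat \<Rightarrow>\<^sub>0 'a::field) set \<Rightarrow> (nat \<Rightarrow>\<^sub>0 'a) set" where
  "veronese n L = pm.span (veronese_vec n ` L)"

definition veronese_variety :: "nat \<Rightarrow> (nat \<Rightarrow>\<^sub>0 'a::field) set set" where
  "veronese_variety n = veronese n ` proj (coord_space (n + 1))"

end

theory Submission
  imports Defs
begin

text \<open>
  A quadric of rank 3 is \<open>AC - B\<^sup>2\<close> for linear forms \<open>A, B, C\<close>; it contains the Veronese variety iff
  \<open>AC = B\<^sup>2\<close> holds for the quadratic forms in \<open>x\<^sub>0, \<dots>, x\<^sub>n\<close> that they induce, which forces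
  \<open>A = s\<^sup>2\<close>, \<open>B = st\<close>, \<open>C = t\<^sup>2\<close> because \<open>A, B, C\<close> are not proportional. Hence the span is generated
  by the quadrics \<open>[s\<^sup>2][t\<^sup>2] - [st]\<^sup>2\<close>, where \<open>[f]\<close> is the linear form that induces \<open>f\<close>. It is compared with \<open>I(X)\<^sub>2\<close> separately in each weight
  \<open>x\<^sub>i x\<^sub>j x\<^sub>k x\<^sub>l\<close>. If an index is repeated, both have the same component. For \<open>i < j < k < l\<close> the component
  of \<open>I(X)\<^sub>2\<close> consists of the \<open>a z\<^sub>i\<^sub>j z\<^sub>k\<^sub>l + b z\<^sub>i\<^sub>k z\<^sub>j\<^sub>l + c z\<^sub>i\<^sub>l z\<^sub>j\<^sub>k\<close> with \<open>a + b + c = 0\<close> and has dimension 2,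
  while the polarization \<open>4 z\<^sub>i\<^sub>k z\<^sub>j\<^sub>l - 2 z\<^sub>i\<^sub>j z\<^sub>k\<^sub>l - 2 z\<^sub>i\<^sub>l z\<^sub>j\<^sub>k\<close> of the generators and its permutations all
  agree in characteristic 3 and span only the line \<open>a = b = c\<close>. So every set of four indices
  contributes 1 to the codimension.
\<close>

section \<open>Preliminaries on fields, dimension and monomials\<close>

text \<open>Over a finite field the product of all \<open>X - a\<close>, increased by 1, would be a
  nonconstant polynomial that takes only the value 1 and so has no root.\<close>

lemma alg_closed_infinite: "infinite (UNIV :: 'a::alg_closed_field set)"
proof
  assume fin: "finite (UNIV :: 'a set)"
  define P where "P = (\<Prod>a\<in>UNIV. [:-a, 1:] :: 'a poly) + 1"
  have "degree (\<Prod>a\<in>UNIV. [:-a, 1:] :: 'a poly) = card (UNIV :: 'a set)"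
    by (subst degree_prod_eq_sum_degree) auto
  moreover have "card (UNIV :: 'a set) > 0"
    using fin by (simp add: card_gt_0_iff)
  ultimately have "degree P > 0"
    unfolding P_def by (subst degree_add_eq_left) auto
  then obtain x where "poly P x = 0"
    using alg_closed_imp_poly_has_root by blast
  moreover have "poly P x = 1"
    using fin by (auto simp: P_def poly_prod)
  ultimately show False by simp
qed

lemma poly_eqI_infinite:
  fixes P Q :: "'a::idom poly"
  assumes "infinite (UNIV :: 'a set)" "\<And>x. poly P x = poly Q x"
  shows "P = Q"
proof -
  have "{x. poly (P - Q) x = 0} = UNIV"
    using assms(2) by auto
  with assms(1) show ?thesis
    using poly_roots_finite[of "P - Q"] by auto
qed

text \<open>Otherwise \<open>X^a\<close> and \<open>X^b\<close> would agree at infinitely many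
  points. This is what separates two monomials with different exponents.\<close>

lemma ex_power_neq:
  fixes a b :: nat
  assumes "infinite (UNIV :: 'a::idom set)" "a \<noteq> b"
  shows "\<exists>t::'a. t ^ a \<noteq> t ^ b"
proof (rule ccontr)
  assume "\<not> ?thesis"
  then have "monom (1::'a) a = monom 1 b"
    by (intro poly_eqI_infinite assms(1)) (simp add: poly_monom)
  then show False
    using assms(2) by (metis coeff_monom zero_neq_one)
qed

lemma sqrt_exists: "\<exists>y::'a::alg_closed_field. y\<^sup>2 = x"
  using nth_root_exists[of 2 x] by auto

text \<open>Each functional lowers the dimension by exactly one, because \<open>E u\<close> lies in
  the kernels of all other functionals but not in that of \<open>phi u\<close>. The finite set
  \<open>F\<close> makes independent sets in \<open>I\<close> finite, so that \<open>dim\<close>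
  behaves as expected.\<close>

lemma dim_common_kernel:
  fixes E :: "'t \<Rightarrow> 'b \<Rightarrow>\<^sub>0 'a::field" and phi :: "'t \<Rightarrow> ('b \<Rightarrow>\<^sub>0 'a) \<Rightarrow> 'a"
  assumes fin: "finite T" and I: "pm.subspace I" "I \<subseteq> pm.span F" "finite F"
    and add: "\<And>t p q. t \<in> T \<Longrightarrow> phi t (p + q) = phi t p + phi t q"
    and scale: "\<And>t c p. t \<in> T \<Longrightarrow> phi t (pscale c p) = c * phi t p"
    and E: "\<And>t. t \<in> T \<Longrightarrow> E t \<in> I"
    and dual: "\<And>t u. t \<in> T \<Longrightarrow> u \<in> T \<Longrightarrow> (phi t (E u) = 0) \<longleftrightarrow> t \<noteq> u"
  shows "pm.dim I = pm.dim {p \<in> I. \<forall>t\<in>T. phi t p = 0} + card T"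
  using fin add scale E dual
proof (induction T rule: finite_induct)
  case empty
  then show ?case by simp
next
  case (insert u T)
  let ?W = "{p \<in> I. \<forall>t\<in>insert u T. phi t p = 0}"
  let ?V = "{p \<in> I. \<forall>t\<in>T. phi t p = 0}"
  have zero: "phi t 0 = 0" if "t \<in> insert u T" for t
    using insert.prems(2)[OF that, of 0 0] by simp
  have V: "pm.subspace ?V" and W: "pm.subspace ?W"
    using I(1) insert.prems(1,2) zero unfolding pm.subspace_def by auto
  obtain B where B: "B \<subseteq> ?W" "pm.independent B" "?W \<subseteq> pm.span B" "card B = pm.dim ?W"
    using pm.basis_exists by blast
  have "B \<subseteq> pm.span F"
    using B(1) I(2) by blast
  then have "finite B"
    using pm.independent_span_bound[OF I(3) B(2)] by blast
  have spanB: "pm.span B = ?W"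
    using B(1,3) W pm.span_minimal by blast
  \<comment> \<open>A basis of \<open>?W\<close> enlarged by \<open>E u\<close> will be a basis of
    \<open>?V\<close>.\<close>
  have "phi u (E u) \<noteq> 0"
    using insert.prems(4)[of u u] by simp
  then have notin: "E u \<notin> pm.span B"
    unfolding spanB by auto
  then have "E u \<notin> B"
    using pm.span_base by blast
  have "E u \<in> ?V"
    using insert.prems(3,4) insert.hyps(2) by auto
  moreover have "B \<subseteq> ?V" using B(1) by auto
  ultimately have "pm.span (insert (E u) B) \<subseteq> ?V"
    by (intro pm.span_minimal V) auto
  moreover have "?V \<subseteq> pm.span (insert (E u) B)"
  proof
    fix p assume p: "p \<in> ?V"
    \<comment> \<open>This multiple of \<open>E u\<close> has the same value under
      \<open>phi u\<close> as \<open>p\<close>, so subtracting it from \<open>p\<close> leads into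
      \<open>?W\<close>.\<close>
    define c where "c = phi u p / phi u (E u)"
    have eq: "p - pscale c (E u) = p + pscale (- c) (E u)"
      by simp
    have "p - pscale c (E u) \<in> ?V"
      using p \<open>E u \<in> ?V\<close> V pm.subspace_diff pm.subspace_scale by blast
    moreover have "phi u (p - pscale c (E u)) = 0"
      using \<open>phi u (E u) \<noteq> 0\<close>
      by (simp only: eq insert.prems(1,2)[OF insertI1]) (simp add: c_def)
    ultimately have "p - pscale c (E u) \<in> pm.span B"
      unfolding spanB by auto
    then show "p \<in> pm.span (insert (E u) B)"
      unfolding pm.span_insert by blast
  qed
  ultimately have "pm.span (insert (E u) B) = ?V" by blast
  moreover have "pm.independent (insert (E u) B)"
    using B(2) notin by (simp add: pm.independent_insert)
  ultimately have "pm.dim ?V = card (insert (E u) B)"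
    using pm.dim_span_eq_card_independent by metis
  also have "\<dots> = pm.dim ?W + 1"
    using \<open>finite B\<close> \<open>E u \<notin> B\<close> B(4) by simp
  finally have "pm.dim ?V = pm.dim ?W + 1" .
  moreover have "pm.dim I = pm.dim ?V + card T"
    using insert.prems by (intro insert.IH) auto
  ultimately show ?case
    using insert.hyps by simp
qed

section \<open>Monomials as functions on points\<close>

definition mon_eval :: "monomial \<Rightarrow> (nat \<Rightarrow> 'a) \<Rightarrow> 'a::comm_ring_1" where
  "mon_eval m x = (\<Prod>i\<in>Poly_Mapping.keys m. x i ^ Poly_Mapping.lookup m i)"

lemma mon_eval_superset:
  assumes "finite S" "Poly_Mapping.keys m \<subseteq> S"
  shows "mon_eval m x = (\<Prod>i\<in>S. x i ^ Poly_Mapping.lookup m i)"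
  unfolding mon_eval_def using assms
  by (intro prod.mono_neutral_left) (auto simp: in_keys_iff)

lemma mon_eval_add: "mon_eval (m + m') x = mon_eval m x * mon_eval m' x"
proof -
  let ?S = "Poly_Mapping.keys m \<union> Poly_Mapping.keys m'"
  have "Poly_Mapping.keys (m + m') \<subseteq> ?S"
    by (rule Poly_Mapping.keys_add)
  then show ?thesis
    by (subst (1 2 3) mon_eval_superset[of ?S])
       (auto simp: lookup_add power_add prod.distrib)
qed

lemma mon_eval_mult: "mon_eval m (\<lambda>i. x i * y i) = mon_eval m x * mon_eval m y"
  by (simp add: mon_eval_def power_mult_distrib prod.distrib)

lemma mon_eval_one [simp]: "mon_eval m (\<lambda>_. 1) = 1"
  by (simp add: mon_eval_def)

text \<open>Monomials are pairwise distinct characters of the monoid of points under the pointwise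
  product, so Dedekind's argument applies.\<close>

lemma mon_eval_independent:
  fixes u :: "monomial \<Rightarrow> 'a::idom"
  assumes inf: "infinite (UNIV :: 'a set)" and "finite T"
    and "\<And>x. (\<Sum>w\<in>T. u w * mon_eval w x) = 0" "w \<in> T"
  shows "u w = 0"
  using assms(2-)
proof (induction T arbitrary: u w rule: finite_induct)
  case empty
  then show ?case by simp
next
  case (insert v T)
  have u0: "u w' = 0" if w': "w' \<in> T" for w'
  proof -
    have "w' \<noteq> v" using w' insert.hyps by auto
    then obtain i where i: "Poly_Mapping.lookup w' i \<noteq> Poly_Mapping.lookup v i"
      by (metis poly_mapping_eqI)
    obtain t :: 'a where t: "t ^ Poly_Mapping.lookup w' i \<noteq> t ^ Poly_Mapping.lookup v i"
      using ex_power_neq[OF inf i] by blast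
    \<comment> \<open>At \<open>y\<close> a monomial takes the value \<open>t\<close> to its
      exponent in variable \<open>i\<close>, so \<open>y\<close> separates \<open>w'\<close> from
      \<open>v\<close>.\<close>
    define y where "y = (\<lambda>j. if j = i then t else 1)"
    have ev: "mon_eval m y = t ^ Poly_Mapping.lookup m i" for m
    proof -
      have "mon_eval m y = (\<Prod>j\<in>insert i (Poly_Mapping.keys m). y j ^ Poly_Mapping.lookup m j)"
        by (rule mon_eval_superset) auto
      also have "\<dots> = t ^ Poly_Mapping.lookup m i"
        by (subst prod.insert_remove) (auto simp: y_def intro: prod.neutral)
      finally show ?thesis .
    qed
    \<comment> \<open>The relation translated by \<open>y\<close>, minus \<open>mon_eval v y\<close>
      times the original relation, has no term for \<open>v\<close>.\<close>
    have "(\<Sum>w\<in>T. u w * (mon_eval w y - mon_eval v y) * mon_eval w x) = 0" for x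
    proof -
      have "0 = (\<Sum>w\<in>insert v T. u w * mon_eval w (\<lambda>i. x i * y i))
          - mon_eval v y * (\<Sum>w\<in>insert v T. u w * mon_eval w x)"
        by (simp only: insert.prems(1) mult_zero_right diff_zero)
      also have "\<dots> = (\<Sum>w\<in>insert v T. u w * (mon_eval w y - mon_eval v y) * mon_eval w x)"
        by (simp only: sum_distrib_left sum_subtractf[symmetric] mon_eval_mult)
           (rule sum.cong, simp_all add: algebra_simps)
      also have "\<dots> = (\<Sum>w\<in>T. u w * (mon_eval w y - mon_eval v y) * mon_eval w x)"
        using insert.hyps by simp
      finally show ?thesis by simp
    qed
    then have "u w' * (mon_eval w' y - mon_eval v y) = 0"
      using insert.IH[of "\<lambda>w. u w * (mon_eval w y - mon_eval v y)" w'] w' by simp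
    then show ?thesis
      using t by (simp add: ev)
  qed
  \<comment> \<open>At the point with all coordinates 1, only the coefficient of \<open>v\<close> is
    left in the relation.\<close>
  moreover have "u v = 0"
    using insert.prems(1)[of "\<lambda>_. 1"] u0 insert.hyps by simp
  ultimately show ?case
    using insert.prems(2) by auto
qed

section \<open>Quadratic forms with \<open>AC = B\<^sup>2\<close>\<close>

definition lf :: "nat \<Rightarrow> (nat \<Rightarrow> 'a) \<Rightarrow> (nat \<Rightarrow> 'a) \<Rightarrow> 'a::comm_ring_1" where
  "lf n s x = (\<Sum>i\<le>n. s i * x i)"

text \<open>A quadratic form is represented as \<open>bf n f x x\<close> with symmetric
  \<open>f\<close>; the two separate arguments also make its polar form available.\<close>

definition bf :: "nat \<Rightarrow> (nat \<Rightarrow> nat \<Rightarrow> 'a) \<Rightarrow> (nat \<Rightarrow> 'a) \<Rightarrow> (nat \<Rightarrow> 'a) \<Rightarrow> 'a::comm_ring_1" where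
  "bf n f x y = (\<Sum>i\<le>n. \<Sum>j\<le>n. f i j * x i * y j)"

section \<open>Restriction of linear and quadratic forms to a line\<close>

lemma lf_line: "lf n s (\<lambda>i. x i + t * y i) = lf n s x + t * lf n s y"
  by (simp add: lf_def sum_distrib_left sum.distrib algebra_simps)

lemma lf_divide: "lf n (\<lambda>i. s i / c) x = lf n s x / (c::'a::field)"
  by (simp add: lf_def sum_divide_distrib)

lemma lf_diff: "lf n (\<lambda>i. a * s i - b * t i) x = a * lf n s x - b * lf n t x"
  by (simp add: lf_def sum_distrib_left sum_subtractf algebra_simps)

lemma bf_lf: "bf n f x p = lf n (\<lambda>i. \<Sum>j\<le>n. f i j * p j) x"
  by (simp add: bf_def lf_def sum_distrib_left sum_distrib_right algebra_simps)

lemma bf_line_left: "bf n f (\<lambda>i. x i + t * y i) p = bf n f x p + t * bf n f y p"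
  by (simp add: bf_lf lf_line)

lemma bf_commute:
  assumes "\<And>i j. f i j = f j i"
  shows "bf n f x y = bf n f y x"
  unfolding bf_def by (subst sum.swap, intro sum.cong refl, subst assms, simp add: mult_ac)

lemma bf_line:
  assumes "\<And>i j. f i j = f j i"
  shows "bf n f (\<lambda>i. x i + t * y i) (\<lambda>i. x i + t * y i)
    = bf n f x x + 2 * t * bf n f x y + t\<^sup>2 * bf n f y y"
proof -
  let ?z = "\<lambda>i. x i + t * y i"
  have "bf n f ?z ?z = bf n f x ?z + t * bf n f y ?z"
    by (rule bf_line_left)
  also have "\<dots> = bf n f ?z x + t * bf n f ?z y"
    using bf_commute[of f, OF assms] by metis
  also have "\<dots> = bf n f x x + t * bf n f y x + t * (bf n f x y + t * bf n f y y)"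
    by (simp only: bf_line_left)
  also have "bf n f y x = bf n f x y"
    by (rule bf_commute[of f, OF assms])
  finally show ?thesis
    by (simp add: algebra_simps power2_eq_square)
qed

text \<open>Stands in for polynomial functions of several variables: restriction to lines suffices
  for cancelling a nonzero factor and involves only univariate polynomials.\<close>

definition poly_on_lines :: "((nat \<Rightarrow> 'a) \<Rightarrow> 'a::comm_ring_1) \<Rightarrow> bool" where
  "poly_on_lines f \<longleftrightarrow> (\<forall>x y. \<exists>P. \<forall>t. f (\<lambda>i. x i + t * y i) = poly P t)"

lemma poly_on_lines_const: "poly_on_lines (\<lambda>_. c)"
  unfolding poly_on_lines_def by (intro allI exI[of _ "[:c:]"]) simp

lemma poly_on_lines_mult:
  assumes "poly_on_lines f" "poly_on_lines g"
  shows "poly_on_lines (\<lambda>x. f x * g x)"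
  using assms unfolding poly_on_lines_def by (metis poly_mult)

lemma poly_on_lines_diff:
  assumes "poly_on_lines f" "poly_on_lines g"
  shows "poly_on_lines (\<lambda>x. f x - g x)"
  using assms unfolding poly_on_lines_def by (metis poly_diff)

lemma poly_on_lines_lf: "poly_on_lines (lf n s)"
  unfolding poly_on_lines_def
proof (intro allI)
  fix x y
  show "\<exists>P. \<forall>t. lf n s (\<lambda>i. x i + t * y i) = poly P t"
    by (rule exI[of _ "[:lf n s x, lf n s y:]"]) (simp add: lf_line)
qed

lemma poly_on_lines_bf_left: "poly_on_lines (\<lambda>x. bf n f x p)"
  unfolding bf_lf by (rule poly_on_lines_lf)

lemma poly_on_lines_bf:
  assumes "\<And>i j. f i j = f j i"
  shows "poly_on_lines (\<lambda>x. bf n f x x)"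
  unfolding poly_on_lines_def
proof (intro allI)
  fix x y
  show "\<exists>P. \<forall>t. bf n f (\<lambda>i. x i + t * y i) (\<lambda>i. x i + t * y i) = poly P t"
    by (rule exI[of _ "[:bf n f x x, 2 * bf n f x y, bf n f y y:]"])
       (simp add: bf_line[of f, OF assms] algebra_simps power2_eq_square)
qed

lemmas poly_on_lines_intros = poly_on_lines_const poly_on_lines_mult poly_on_lines_diff
  poly_on_lines_lf poly_on_lines_bf_left poly_on_lines_bf

text \<open>On the line that passes through \<open>x0\<close> at parameter 0 and through
  \<open>x\<close> at parameter 1, the product is the zero polynomial while the factor from
  \<open>f\<close> is not.\<close>

lemma poly_on_lines_zero_divisor:
  fixes f g :: "(nat \<Rightarrow> 'a::idom) \<Rightarrow> 'a"
  assumes "infinite (UNIV :: 'a set)" "poly_on_lines f" "poly_on_lines g"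
    and "\<And>x. f x * g x = 0" "f x0 \<noteq> 0"
  shows "g x = 0"
proof -
  let ?l = "\<lambda>t i. x0 i + t * (x i - x0 i)"
  obtain P where P: "\<And>t. f (?l t) = poly P t"
    using assms(2) unfolding poly_on_lines_def by (elim allE[of _ x0] allE[of _ "\<lambda>i. x i - x0 i"]) auto
  obtain Q where Q: "\<And>t. g (?l t) = poly Q t"
    using assms(3) unfolding poly_on_lines_def by (elim allE[of _ x0] allE[of _ "\<lambda>i. x i - x0 i"]) auto
  have "P * Q = 0"
    by (rule poly_eqI_infinite[OF assms(1)]) (simp add: P[symmetric] Q[symmetric] assms(4))
  moreover have "poly P 0 \<noteq> 0"
    using P[of 0] assms(5) by simp
  ultimately have "Q = 0" by auto
  then show ?thesis
    using Q[of 1] by simp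
qed

text \<open>The quadratic formula for \<open>a0 + 2 a1 t + a2 t^2\<close>, where \<open>e\<close> is
  a root of the reduced discriminant.\<close>

lemma complete_square:
  fixes t :: "'a::comm_ring_1"
  assumes "a2 * t = e - a1" "e\<^sup>2 = a1 * a1 - a0 * a2"
  shows "a2 * (a0 + 2 * t * a1 + t\<^sup>2 * a2) = 0"
proof -
  have "a2 * (a0 + 2 * t * a1 + t\<^sup>2 * a2) = a0 * a2 + 2 * (a2 * t) * a1 + (a2 * t)\<^sup>2"
    by (simp add: algebra_simps power2_eq_square)
  also have "\<dots> = a0 * a2 - a1 * a1 + e\<^sup>2"
    unfolding assms(1) by (simp add: algebra_simps power2_eq_square)
  finally show ?thesis
    by (simp add: assms(2))
qed

text \<open>Two different roots have the product \<open>a0 / a2\<close>. The form without division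
  also covers \<open>a2 = 0\<close>, which may occur for \<open>B\<close> below.\<close>

lemma vieta_constant_coeff:
  fixes t1 t2 :: "'a::comm_ring_1"
  assumes "a0 + 2 * t1 * a1 + t1\<^sup>2 * a2 = 0" "a0 + 2 * t2 * a1 + t2\<^sup>2 * a2 = 0"
  shows "(t1 - t2) * (a0 - t1 * t2 * a2) = 0"
proof -
  have "(t1 - t2) * (a0 - t1 * t2 * a2)
    = t1 * (a0 + 2 * t2 * a1 + t2\<^sup>2 * a2) - t2 * (a0 + 2 * t1 * a1 + t1\<^sup>2 * a2)"
    by (simp add: algebra_simps power2_eq_square)
  then show ?thesis
    by (simp add: assms)
qed

text \<open>If \<open>A(p) \<noteq> 0\<close> and the discriminant of \<open>A\<close> on the line through \<open>y\<close> in direction \<open>p\<close> is not zero,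
  then \<open>A\<close> has two different zeros on this line and \<open>B\<close> vanishes there, too, so that \<open>B\<close> is a
  multiple of \<open>A\<close> on this line. If the discriminant vanishes for all \<open>y\<close>, then \<open>A\<close> is a square.\<close>

lemma quadratic_forms_mult_eq_square:
  fixes A B C :: "nat \<Rightarrow> nat \<Rightarrow> 'a::alg_closed_field"
  assumes sym: "\<And>i j. A i j = A j i" "\<And>i j. B i j = B j i" "\<And>i j. C i j = C j i"
    and two: "(2::'a) \<noteq> 0"
    and eq: "\<And>x. bf n A x x * bf n C x x = (bf n B x x)\<^sup>2"
  obtains (zero) "\<And>x. bf n A x x = 0" "\<And>x. bf n B x x = 0"
  | (proportional) b where "\<And>x. bf n B x x = b * bf n A x x" "\<And>x. bf n C x x = b\<^sup>2 * bf n A x x"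
  | (square) s t where "\<And>x. bf n A x x = (lf n s x)\<^sup>2" "\<And>x. bf n C x x = (lf n t x)\<^sup>2"
      "\<And>x. bf n B x x = lf n s x * lf n t x"
proof -
  note lineA = bf_line[of A, OF sym(1)] and lineB = bf_line[of B, OF sym(2)]
  note dom = poly_on_lines_zero_divisor[OF alg_closed_infinite]
  have A0B0: "bf n B x x = 0" if "bf n A x x = 0" for x
    using eq[of x] that by simp
  show thesis
  proof (cases "\<forall>x. bf n A x x = 0")
    case True
    then show ?thesis using A0B0 zero by blast
  next
    case False
    then obtain p where p: "bf n A p p \<noteq> 0" by blast
    \<comment> \<open>A quarter of the discriminant of \<open>A\<close> on the line
      \<open>y + t p\<close>, as a quadratic polynomial in \<open>t\<close>.\<close>
    define D where "D = (\<lambda>y. bf n A y p * bf n A y p - bf n A y y * bf n A p p)"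
    show ?thesis
    proof (cases "\<forall>y. D y = 0")
      case True
      obtain \<rho> where \<rho>: "\<rho>\<^sup>2 = bf n A p p" using sqrt_exists by blast
      have "\<rho> \<noteq> 0" using \<rho> p by auto
      \<comment> \<open>Since \<open>D\<close> vanishes, \<open>A(y) A(p)\<close> is the square of
        the polar form of \<open>y\<close> and \<open>p\<close>; dividing the latter by
        \<open>\<rho>\<close> gives a square root of \<open>A\<close>.\<close>
      define s where "s = (\<lambda>i. (\<Sum>j\<le>n. A i j * p j) / \<rho>)"
      have s: "lf n s y = bf n A y p / \<rho>" for y
        unfolding s_def bf_lf by (rule lf_divide)
      have As: "bf n A y y = (lf n s y)\<^sup>2" for y
        using True[rule_format, of y] \<rho> p \<open>\<rho> \<noteq> 0\<close>
        by (simp add: D_def s power_divide field_simps power2_eq_square)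
      have sp: "lf n s p = \<rho>"
        using \<rho> \<open>\<rho> \<noteq> 0\<close> by (simp add: s field_simps power2_eq_square)
      \<comment> \<open>The cofactor of \<open>s\<close> that results from solving
        \<open>B(u) = 0\<close> for \<open>B(y)\<close>, where \<open>u\<close> is the zero of
        \<open>s\<close> on the line through \<open>y\<close> in direction \<open>p\<close>.\<close>
      define t where "t = (\<lambda>i. 2 / \<rho> * (\<Sum>j\<le>n. B i j * p j) - bf n B p p / \<rho>\<^sup>2 * s i)"
      have t: "lf n t y = 2 / \<rho> * bf n B y p - bf n B p p / \<rho>\<^sup>2 * lf n s y" for y
        unfolding t_def bf_lf by (rule lf_diff)
      have Bst: "bf n B y y = lf n s y * lf n t y" for y
      proof -
        let ?\<tau> = "- (lf n s y / \<rho>)"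
        let ?u = "\<lambda>i. y i + ?\<tau> * p i"
        have "lf n s ?u = 0"
          unfolding lf_line sp using \<open>\<rho> \<noteq> 0\<close> by simp
        then have "bf n B ?u ?u = 0"
          by (intro A0B0) (simp only: As power_zero_numeral)
        then show ?thesis
          unfolding lineB t using \<open>\<rho> \<noteq> 0\<close> by (simp add: field_simps power2_eq_square)
      qed
      \<comment> \<open>After multiplication by \<open>A\<close> this is \<open>AC = B^2\<close>;
        the factor \<open>A\<close> can be cancelled because it is not zero at
        \<open>p\<close>.\<close>
      have "bf n C x x - lf n t x * lf n t x = 0" for x
      proof (rule dom[of "\<lambda>x. bf n A x x" "\<lambda>x. bf n C x x - lf n t x * lf n t x" p])
        show "bf n A x x * (bf n C x x - lf n t x * lf n t x) = 0" for x
          using eq[of x] by (simp add: As Bst algebra_simps power2_eq_square)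
        show "poly_on_lines (\<lambda>x. bf n C x x - lf n t x * lf n t x)"
          by (intro poly_on_lines_intros sym)
      qed (intro poly_on_lines_bf sym p)+
      then show ?thesis
        using square As Bst by (metis eq_iff_diff_eq_0 power2_eq_square)
    next
      case False
      then obtain y0 where y0: "D y0 \<noteq> 0" by blast
      \<comment> \<open>The ratio of the leading coefficients of \<open>B\<close> and
        \<open>A\<close> on every line in direction \<open>p\<close>.\<close>
      define b where "b = bf n B p p / bf n A p p"
      have D: "poly_on_lines D"
        unfolding D_def
        by (intro poly_on_lines_intros sym)
      \<comment> \<open>The factor \<open>D\<close> makes the claim trivial where the two zeros of
        \<open>A\<close> coincide; it is cancelled afterwards.\<close>
      have BA0: "D y * (bf n B y y - b * bf n A y y) = 0" for y
      proof (cases "D y = 0")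
        case False
        obtain \<delta> where \<delta>: "\<delta>\<^sup>2 = D y" using sqrt_exists by blast
        have root: "bf n B y y + 2 * t * bf n B y p + t\<^sup>2 * bf n B p p = 0"
          if "t = (- bf n A y p + e) / bf n A p p" "e\<^sup>2 = D y" for t e
        proof -
          have "bf n A p p * t = e - bf n A y p"
            using that(1) p by simp
          moreover have "e\<^sup>2 = bf n A y p * bf n A y p - bf n A y y * bf n A p p"
            using that(2) by (simp add: D_def)
          ultimately have "bf n A p p * (bf n A y y + 2 * t * bf n A y p + t\<^sup>2 * bf n A p p) = 0"
            by (rule complete_square)
          then have "bf n A y y + 2 * t * bf n A y p + t\<^sup>2 * bf n A p p = 0"
            using p by simp
          then show ?thesis
            using A0B0[of "\<lambda>i. y i + t * p i"] by (simp add: lineA lineB)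
        qed
        define t1 t2 where "t1 = (- bf n A y p + \<delta>) / bf n A p p" and "t2 = (- bf n A y p - \<delta>) / bf n A p p"
        have "bf n B y y + 2 * t1 * bf n B y p + t1\<^sup>2 * bf n B p p = 0"
          by (rule root[of t1 \<delta>]) (simp_all add: t1_def \<delta>)
        moreover have "bf n B y y + 2 * t2 * bf n B y p + t2\<^sup>2 * bf n B p p = 0"
          by (rule root[of t2 "-\<delta>"]) (simp_all add: t2_def \<delta>)
        ultimately have prod: "(t1 - t2) * (bf n B y y - t1 * t2 * bf n B p p) = 0"
          by (rule vieta_constant_coeff)
        have "(t1 - t2) * bf n A p p = 2 * \<delta>"
          using p by (simp add: t1_def t2_def field_simps)
        then have "t1 \<noteq> t2"
          using \<delta> False two by auto
        \<comment> \<open>The two zeros \<open>t1\<close>, \<open>t2\<close> are common to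
          \<open>A\<close> and \<open>B\<close>, so their product relates constant and leading
          coefficient in the same way for both forms.\<close>
        with prod have B: "bf n B y y = t1 * t2 * bf n B p p"
          by simp
        have "t1 * t2 * bf n A p p = (bf n A y p * bf n A y p - \<delta>\<^sup>2) / bf n A p p"
          using p by (simp add: t1_def t2_def field_simps power2_eq_square)
        then have A: "t1 * t2 * bf n A p p = bf n A y y"
          using \<delta> p by (simp add: D_def)
        show ?thesis
          using p by (simp add: b_def B A[symmetric])
      qed auto
      have BA: "bf n B x x - b * bf n A x x = 0" for x
        by (rule dom[OF D _ BA0 y0])
          (intro poly_on_lines_intros sym)
      have "bf n C x x - b\<^sup>2 * bf n A x x = 0" for x
      proof (rule dom[of "\<lambda>x. bf n A x x" "\<lambda>x. bf n C x x - b\<^sup>2 * bf n A x x" p])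
        show "bf n A x x * (bf n C x x - b\<^sup>2 * bf n A x x) = 0" for x
          using eq[of x] BA[of x] by (simp add: algebra_simps power2_eq_square)
        show "poly_on_lines (\<lambda>x. bf n C x x - b\<^sup>2 * bf n A x x)"
          by (intro poly_on_lines_intros sym)
      qed (intro poly_on_lines_bf sym p)+
      with BA show ?thesis
        by (intro proportional[of b]) simp_all
    qed
  qed
qed

section \<open>Symmetric matrices as sums of squares\<close>

text \<open>One step of Gram-Schmidt orthogonalization lowers the length of a factorization by one.\<close>

lemma symmetric_sum_of_squares:
  fixes M :: "nat \<Rightarrow> nat \<Rightarrow> 'a::alg_closed_field" and R :: "'b \<Rightarrow> nat \<Rightarrow> 'a"
  assumes "finite S" "(2::'a) \<noteq> 0"
    and "\<And>i j. i < N \<Longrightarrow> j < N \<Longrightarrow> M i j = M j i"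
    and "\<And>i j. i < N \<Longrightarrow> j < N \<Longrightarrow> M i j = (\<Sum>a\<in>S. P a i * R a j)"
  shows "\<exists>f. \<forall>i<N. \<forall>j<N. M i j = (\<Sum>k<card S. f k i * f k j)"
  using assms
proof (induction "card S" arbitrary: S M P R)
  case 0
  then show ?case by simp
next
  case (Suc d)
  note sym = Suc.prems(3) and fac = Suc.prems(4)
  show ?case
  proof (cases "\<forall>i<N. \<forall>j<N. M i j = 0")
    case True
    then show ?thesis
      by (intro exI[of _ "\<lambda>_ _. 0"]) simp
  next
    case False
    \<comment> \<open>The vector \<open>e_p + c e_q\<close> is to be non-isotropic for
      \<open>M\<close>. A nonzero diagonal entry allows \<open>c = 0\<close>; if the diagonal
      vanishes, \<open>c = 1\<close> gives the value \<open>2 * M p q\<close>.\<close>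
    then obtain p q c where pq: "p < N" "q < N"
      and nz: "M p p + c * M p q + c * (M q p + c * M q q) \<noteq> 0"
    proof (cases "\<exists>p<N. M p p \<noteq> 0")
      case True
      then obtain p where "p < N" "M p p \<noteq> 0" by blast
      then show ?thesis using that[of p p 0] by simp
    next
      case diag: False
      then obtain p q where pq: "p < N" "q < N" "M p q \<noteq> 0"
        using False by blast
      then have "M p p + 1 * M p q + 1 * (M q p + 1 * M q q) = 2 * M p q"
        using diag sym[of p q] by simp
      then have "M p p + 1 * M p q + 1 * (M q p + 1 * M q q) \<noteq> 0"
        using pq(3) Suc.prems(2) by (metis mult_eq_0_iff)
      then show ?thesis
        using that pq by blast
    qed
    \<comment> \<open>\<open>w\<close> is \<open>M\<close> applied to the chosen vector and
      \<open>\<alpha>\<close> is the value of the form there, so that \<open>M'\<close> has this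
      vector in its kernel.\<close>
    define w where "w = (\<lambda>i. M i p + c * M i q)"
    define \<alpha> where "\<alpha> = w p + c * w q"
    have \<alpha>: "\<alpha> \<noteq> 0"
      using nz by (simp add: \<alpha>_def w_def algebra_simps)
    define M' where "M' = (\<lambda>i j. M i j - w i * w j / \<alpha>)"
    define \<rho> where "\<rho> = (\<lambda>a. R a p + c * R a q)"
    have w: "w i = (\<Sum>a\<in>S. P a i * \<rho> a)" if "i < N" for i
      unfolding w_def \<rho>_def using that pq
      by (simp add: fac sum.distrib sum_distrib_left algebra_simps)
    have "\<exists>a\<in>S. \<rho> a \<noteq> 0"
    proof (rule ccontr)
      assume "\<not> ?thesis"
      then have "w p = 0" "w q = 0"
        using w pq by auto
      then show False using \<alpha> by (simp add: \<alpha>_def)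
    qed
    then obtain a0 where a0: "a0 \<in> S" "\<rho> a0 \<noteq> 0" by blast
    \<comment> \<open>With \<open>P'\<close> in place of \<open>P\<close> the product becomes
      \<open>M'\<close>, and \<open>P'\<close> is orthogonal to \<open>\<rho>\<close>. Hence a
      multiple of \<open>\<rho>\<close> may be subtracted from \<open>R\<close>; the multiple in
      \<open>R'\<close> makes the term for \<open>a0\<close> vanish.\<close>
    define P' where "P' = (\<lambda>a i. P a i - w i * (P a p + c * P a q) / \<alpha>)"
    define R' where "R' = (\<lambda>a j. R a j - \<rho> a * R a0 j / \<rho> a0)"
    have fac': "M' i j = (\<Sum>a\<in>S - {a0}. P' a i * R' a j)" if ij: "i < N" "j < N" for i j
    proof -
      have 1: "(\<Sum>a\<in>S. P' a i * R a j) = M' i j"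
      proof -
        have "(\<Sum>a\<in>S. P' a i * R a j) = (\<Sum>a\<in>S. P a i * R a j)
            - w i / \<alpha> * ((\<Sum>a\<in>S. P a p * R a j) + c * (\<Sum>a\<in>S. P a q * R a j))"
          unfolding P'_def sum_distrib_left sum.distrib[symmetric] sum_subtractf[symmetric]
          by (rule sum.cong) (simp_all add: field_simps)
        also have "\<dots> = M i j - w i / \<alpha> * (M p j + c * M q j)"
          using ij pq by (simp add: fac)
        also have "\<dots> = M' i j"
          using ij pq sym[of j p] sym[of j q] by (simp add: M'_def w_def)
        finally show ?thesis .
      qed
      have 2: "(\<Sum>a\<in>S. P' a i * \<rho> a) = 0"
      proof -
        have "(\<Sum>a\<in>S. P' a i * \<rho> a) = (\<Sum>a\<in>S. P a i * \<rho> a)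
            - w i / \<alpha> * ((\<Sum>a\<in>S. P a p * \<rho> a) + c * (\<Sum>a\<in>S. P a q * \<rho> a))"
          unfolding P'_def sum_distrib_left sum.distrib[symmetric] sum_subtractf[symmetric]
          by (rule sum.cong) (simp_all add: field_simps)
        also have "\<dots> = w i - w i / \<alpha> * \<alpha>"
          using ij pq by (simp add: w \<alpha>_def)
        finally show ?thesis using \<alpha> by simp
      qed
      have "(\<Sum>a\<in>S - {a0}. P' a i * R' a j) = (\<Sum>a\<in>S. P' a i * R' a j)"
        using Suc.prems(1) a0 by (subst (2) sum.remove[of _ a0]) (simp_all add: R'_def)
      also have "\<dots> = (\<Sum>a\<in>S. P' a i * R a j) - (\<Sum>a\<in>S. P' a i * \<rho> a) * (R a0 j / \<rho> a0)"
        unfolding R'_def sum_distrib_right sum_subtractf[symmetric]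
        by (rule sum.cong) (simp_all add: algebra_simps)
      finally show ?thesis by (simp add: 1 2)
    qed
    have card: "card (S - {a0}) = d"
      using Suc.hyps(2) Suc.prems(1) a0(1) by simp
    have "M' i j = M' j i" if "i < N" "j < N" for i j
      using sym[OF that] by (simp add: M'_def mult.commute)
    then have "\<exists>f. \<forall>i<N. \<forall>j<N. M' i j = (\<Sum>k<card (S - {a0}). f k i * f k j)"
      using fac' Suc.prems(1,2) card by (intro Suc.hyps(1)) auto
    then obtain f where f: "\<And>i j. i < N \<Longrightarrow> j < N \<Longrightarrow> M' i j = (\<Sum>k<d. f k i * f k j)"
      unfolding card by blast
    \<comment> \<open>The removed part of \<open>M\<close> is the square of \<open>w\<close> divided
      by \<open>\<beta>\<close>, which becomes the last summand.\<close>
    obtain \<beta> where \<beta>: "\<beta>\<^sup>2 = \<alpha>" using sqrt_exists by blast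
    have "M i j = (\<Sum>k<card S. (f(d := \<lambda>i. w i / \<beta>)) k i * (f(d := \<lambda>i. w i / \<beta>)) k j)"
      if "i < N" "j < N" for i j
      using f[OF that] \<beta> by (simp add: Suc.hyps(2)[symmetric] M'_def power2_eq_square algebra_simps)
    then show ?thesis by blast
  qed
qed

section \<open>Rank as the number of terms in a factorization\<close>

context vec_space
begin

text \<open>A maximal independent set \<open>S\<close> of columns spans all columns;
  \<open>R\<close> records the coefficients of the columns with respect to \<open>S\<close>.\<close>

lemma rank_factorization:
  assumes A: "A \<in> carrier_mat n nc"
  obtains S :: "'a vec set" and R where "finite S" "card S = rank A"
    "\<And>i j. i < n \<Longrightarrow> j < nc \<Longrightarrow> A $$ (i, j) = (\<Sum>a\<in>S. a $ i * R a j)"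
proof -
  let ?P = "\<lambda>T. T \<subseteq> set (cols A) \<and> lin_indpt T"
  obtain S where S: "maximal S ?P" "finite S"
    using maximal_exists_superset[of "set (cols A)" ?P "{}"] finite_lin_indpt2[of "{}"] by auto
  have sub: "set (cols A) \<subseteq> carrier_vec n"
    using cols_dim A by blast
  have S': "S \<subseteq> set (cols A)" "lin_indpt S" "S \<subseteq> carrier_vec n"
    using S(1) sub by (auto simp: maximal_def)
  have in_span: "s \<in> span S" if "s \<in> set (cols A)" for s
  proof (rule ccontr)
    assume s: "s \<notin> span S"
    then have "lin_indpt (S \<union> {s})"
      using S' that sub by (meson lin_dep_iff_in_span rev_subsetD span_mem)
    moreover have "s \<notin> S"
      using s S' span_mem by auto
    ultimately show False
      using S(1) S'(1) that unfolding maximal_def by blast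
  qed
  have "\<exists>r. \<forall>i<n. A $$ (i, j) = (\<Sum>a\<in>S. a $ i * r a)" if j: "j < nc" for j
  proof -
    have "col A j \<in> span S"
      using in_span j A by (metis carrier_matD(2) cols_length cols_nth nth_mem)
    then obtain r where r: "col A j = lincomb r S"
      using finite_in_span[OF S(2) _ \<open>col A j \<in> span S\<close>] S'(3) by metis
    have "A $$ (i, j) = (\<Sum>a\<in>S. a $ i * r a)" if i: "i < n" for i
    proof -
      have "A $$ (i, j) = lincomb r S $ i"
        using r i j A by (metis carrier_matD index_col)
      also have "\<dots> = (\<Sum>a\<in>S. a $ i * r a)"
        using lincomb_index[OF i S'(3), of r] by (simp add: mult.commute)
      finally show ?thesis .
    qed
    then show ?thesis by blast
  qed
  then obtain r where "\<And>i j. i < n \<Longrightarrow> j < nc \<Longrightarrow> A $$ (i, j) = (\<Sum>a\<in>S. a $ i * r j a)"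
    by metis
  then show ?thesis
    using that[of S "\<lambda>a j. r j a"] S(2) rank_card_indpt[OF A S(1)] by simp
qed

end

lemma symmetric_mat_sum_of_squares:
  fixes A :: "'a::alg_closed_field mat"
  assumes A: "A \<in> carrier_mat N N" and "(2::'a) \<noteq> 0"
    and "\<And>i j. i < N \<Longrightarrow> j < N \<Longrightarrow> A $$ (i, j) = A $$ (j, i)"
  obtains f where "\<And>i j. i < N \<Longrightarrow> j < N \<Longrightarrow>
    A $$ (i, j) = (\<Sum>k<vec_space.rank N A. f k i * f k j)"
proof -
  obtain S R where S: "finite S" "card S = vec_space.rank N A"
    and fac: "\<And>i j. i < N \<Longrightarrow> j < N \<Longrightarrow> A $$ (i, j) = (\<Sum>a\<in>S. a $ i * R a j)"
    using vec_space.rank_factorization[OF A] by blast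
  obtain f where f: "\<forall>i<N. \<forall>j<N. A $$ (i, j) = (\<Sum>k<card S. f k i * f k j)"
    using symmetric_sum_of_squares[of S N "\<lambda>i j. A $$ (i, j)" "\<lambda>a i. a $ i" R] S(1) assms(2,3) fac
    by auto
  then show ?thesis
    by (intro that) (simp add: S(2))
qed

text \<open>Each product contributes a matrix of rank at most 1, and the rank is
  subadditive.\<close>

lemma rank_sum_of_products:
  fixes A :: "'a::field mat" and f g :: "nat \<Rightarrow> nat \<Rightarrow> 'a"
  assumes "A \<in> carrier_mat N N"
    and "\<And>i j. i < N \<Longrightarrow> j < N \<Longrightarrow> A $$ (i, j) = (\<Sum>k<d. f k i * g k j)"
  shows "vec_space.rank N A \<le> d"
  using assms
proof (induction d arbitrary: A)
  case 0
  then have "A = 0\<^sub>m N N" by (intro eq_matI) auto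
  then show ?case by (simp add: vec_space.rank_0I)
next
  case (Suc d)
  let ?B = "mat N N (\<lambda>(i, j). \<Sum>k<d. f k i * g k j)"
  let ?C = "mat N N (\<lambda>(i, j). f d i * g d j)"
  have "A = ?B + ?C"
    using Suc.prems by (intro eq_matI) auto
  then have "vec_space.rank N A \<le> vec_space.rank N ?B + vec_space.rank N ?C"
    using vec_space.rank_subadditive[of ?B N N ?C] by simp
  moreover have "vec_space.rank N ?B \<le> d"
    by (rule Suc.IH) auto
  moreover have "vec_space.rank N ?C \<le> 1"
    by (rule vec_space.rank_le_1_product_entries[of _ _ N "f d" "g d"]) auto
  ultimately show ?case by simp
qed

section \<open>Quadratic forms in the coordinates of the Veronese embedding\<close>

definition var :: "nat \<Rightarrow> monomial" where
  "var k = Poly_Mapping.single k 1"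

lemma lookup_var [simp]: "Poly_Mapping.lookup (var k) i = of_bool (i = k)"
  by (simp add: var_def lookup_single when_def)

lemma keys_var [simp]: "Poly_Mapping.keys (var k) = {k}"
  by (simp add: var_def)

lemma mon_eval_var [simp]: "mon_eval (var k) x = x k"
  by (simp add: mon_eval_def)

lemma mon_degree_add: "mon_degree (m + m') = mon_degree m + mon_degree m'"
proof -
  have deg: "mon_degree m = (\<Sum>i\<in>S. Poly_Mapping.lookup m i)"
    if "finite S" "Poly_Mapping.keys m \<subseteq> S" for m S
    unfolding mon_degree_def using that by (intro sum.mono_neutral_left) (auto simp: in_keys_iff)
  let ?S = "Poly_Mapping.keys m \<union> Poly_Mapping.keys m'"
  have "Poly_Mapping.keys (m + m') \<subseteq> ?S"
    by (rule Poly_Mapping.keys_add)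
  then show ?thesis
    by (subst (1 2 3) deg[of ?S]) (auto simp: lookup_add sum.distrib)
qed

lemma mon_degree_var [simp]: "mon_degree (var k) = 1"
  by (simp add: mon_degree_def)

lemma mon_degree_eq_0: "mon_degree m = 0 \<longleftrightarrow> m = 0"
proof -
  have "mon_degree m = 0 \<longleftrightarrow> (\<forall>i\<in>Poly_Mapping.keys m. Poly_Mapping.lookup m i = 0)"
    by (simp add: mon_degree_def)
  also have "\<dots> \<longleftrightarrow> Poly_Mapping.keys m = {}"
    by (metis all_not_in_conv in_keys_iff)
  finally show ?thesis by simp
qed

lemma var_dvd:
  assumes "k \<in> Poly_Mapping.keys m"
  obtains m' where "m = var k + m'" "Poly_Mapping.keys m' \<subseteq> Poly_Mapping.keys m"
proof -
  have "m = var k + (m - var k)"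
    using assms by (intro poly_mapping_eqI) (auto simp: lookup_add lookup_minus in_keys_iff)
  moreover have "Poly_Mapping.keys (m - var k) \<subseteq> Poly_Mapping.keys m"
    by (auto simp: in_keys_iff lookup_minus)
  ultimately show ?thesis by (rule that)
qed

lemma mon_degree_2E:
  assumes "mon_degree m = 2" "Poly_Mapping.keys m \<subseteq> A"
  obtains p q where "p \<in> A" "q \<in> A" "m = var p + var q"
proof -
  have nonempty: "\<exists>k. k \<in> Poly_Mapping.keys m'" if "mon_degree m' \<noteq> 0" for m'
    using that by (metis all_not_in_conv keys_eq_empty mon_degree_eq_0)
  obtain p where pm: "p \<in> Poly_Mapping.keys m"
    using nonempty[of m] assms(1) by auto
  obtain m' where p: "m = var p + m'" "Poly_Mapping.keys m' \<subseteq> Poly_Mapping.keys m"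
    by (rule var_dvd[OF pm])
  have "mon_degree m' = 1"
    using assms(1) p(1) by (simp add: mon_degree_add)
  obtain q where qm: "q \<in> Poly_Mapping.keys m'"
    using nonempty[of m'] \<open>mon_degree m' = 1\<close> by auto
  obtain m'' where q: "m' = var q + m''"
    by (rule var_dvd[OF qm])
  with \<open>mon_degree m' = 1\<close> have "m'' = 0"
    by (simp add: mon_degree_add mon_degree_eq_0)
  then have "m = var p + var q"
    using p(1) q by simp
  moreover have "p \<in> A" "q \<in> A"
    using pm qm p(2) assms(2) by auto
  ultimately show ?thesis
    using that by simp
qed

lemma lookup_var_sum: "Poly_Mapping.lookup (var p + var q) k = of_bool (k = p) + of_bool (k = q)"
  by (simp add: lookup_add)

lemma var_add_eq_iff: "var p + var q = var p' + var q' \<longleftrightarrow> p = p' \<and> q = q' \<or> p = q' \<and> q = p'"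
proof
  assume *: "var p + var q = var p' + var q'"
  have "of_bool (k = p) + of_bool (k = q) = (of_bool (k = p') + of_bool (k = q') :: nat)" for k
    using * lookup_var_sum by metis
  from this[of p] this[of q] show "p = p' \<and> q = q' \<or> p = q' \<and> q = p'"
    by (cases "p = p'"; cases "p = q'"; cases "q = p'"; cases "q = q'"; simp)
qed (auto simp: add.commute)

lemma keys_var_add [simp]: "Poly_Mapping.keys (var p + var q) = {p, q}"
  by (auto simp: in_keys_iff lookup_var_sum)

lemma eval_poly_mon_eval:
  "eval_poly Q z = (\<Sum>m\<in>Poly_Mapping.keys Q. Poly_Mapping.lookup Q m * mon_eval m (Poly_Mapping.lookup z))"
  by (simp add: eval_poly_def mon_eval_def)

lemma quadratic_formsE:
  assumes "Q \<in> quadratic_forms r" "m \<in> Poly_Mapping.keys Q"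
  obtains p q where "p \<le> r" "q \<le> r" "m = var p + var q"
proof (rule mon_degree_2E[of m "{..r}"])
  show "mon_degree m = 2" "Poly_Mapping.keys m \<subseteq> {..r}"
    using assms by (auto simp: quadratic_forms_def)
qed (use that in auto)

section \<open>The symmetric matrix of a quadratic form\<close>

lemma sym_matrix_index:
  assumes "i < r + 1" "j < r + 1"
  shows "sym_matrix r Q $$ (i, j) = (if i = j then 1 else 1 / 2) * Poly_Mapping.lookup Q (var i + var j)"
  using assms by (simp add: sym_matrix_def Let_def var_def)

lemma sym_matrix_carrier: "sym_matrix r Q \<in> carrier_mat (r + 1) (r + 1)"
  by (simp add: sym_matrix_def)

lemma sym_matrix_sym:
  assumes "i < r + 1" "j < r + 1"
  shows "sym_matrix r Q $$ (i, j) = sym_matrix r Q $$ (j, i)"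
  using assms by (simp add: sym_matrix_index add.commute)

lemma lookup_sym_matrix:
  fixes Q :: "'a::field mpoly"
  assumes "p \<le> r" "q \<le> r" "p \<noteq> q" "(2::'a) \<noteq> 0"
  shows "Poly_Mapping.lookup Q (var p + var q) = 2 * sym_matrix r Q $$ (p, q)"
  using assms by (simp add: sym_matrix_index)

text \<open>The index pairs are grouped by their monomial. A mixed monomial comes from two pairs
  with equal entries, which undoes the division by 2.\<close>

lemma eval_poly_sym_matrix:
  fixes Q :: "'a::field mpoly"
  assumes Q: "Q \<in> quadratic_forms r" and two: "(2::'a) \<noteq> 0"
  shows "eval_poly Q z = (\<Sum>i\<le>r. \<Sum>j\<le>r. sym_matrix r Q $$ (i, j) *
    (Poly_Mapping.lookup z i * Poly_Mapping.lookup z j))"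
proof -
  define g where "g = (\<lambda>x. var (fst x) + var (snd x))"
  define h where "h = (\<lambda>x. sym_matrix r Q $$ (fst x, snd x) *
    (Poly_Mapping.lookup z (fst x) * Poly_Mapping.lookup z (snd x)))"
  let ?D = "{..r} \<times> {..r}"
  let ?f = "\<lambda>m. Poly_Mapping.lookup Q m * mon_eval m (Poly_Mapping.lookup z)"
  have "Poly_Mapping.keys Q \<subseteq> g ` ?D"
  proof
    fix m assume "m \<in> Poly_Mapping.keys Q"
    then obtain p q where "p \<le> r" "q \<le> r" "m = var p + var q"
      by (rule quadratic_formsE[OF Q])
    then show "m \<in> g ` ?D"
      by (intro image_eqI[of _ _ "(p, q)"]) (simp_all add: g_def)
  qed
  then have "eval_poly Q z = (\<Sum>m\<in>g ` ?D. ?f m)"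
    unfolding eval_poly_mon_eval by (intro sum.mono_neutral_left) (auto simp: in_keys_iff)
  also have "\<dots> = (\<Sum>m\<in>g ` ?D. \<Sum>x\<in>{x \<in> ?D. g x = m}. h x)"
  proof (rule sum.cong[OF refl])
    fix m assume "m \<in> g ` ?D"
    then obtain p q where pq: "p \<le> r" "q \<le> r" "m = var p + var q"
      by (auto simp: g_def)
    have eq: "{x \<in> ?D. g x = m} = {(p, q), (q, p)}"
      using pq by (auto simp: g_def var_add_eq_iff)
    show "?f m = (\<Sum>x\<in>{x \<in> ?D. g x = m}. h x)"
    proof (cases "p = q")
      case True
      then show ?thesis
        unfolding eq using pq by (simp add: h_def mon_eval_add sym_matrix_index)
    next
      case False
      have "h (q, p) = h (p, q)"
        using pq sym_matrix_sym[of q r p Q] by (simp add: h_def mult.commute)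
      with False have "(\<Sum>x\<in>{x \<in> ?D. g x = m}. h x) = 2 * h (p, q)"
        unfolding eq by simp
      also have "\<dots> = ?f m"
        using lookup_sym_matrix[OF pq(1,2) False two, of Q] pq(3) by (simp add: h_def mon_eval_add)
      finally show ?thesis by simp
    qed
  qed
  also have "\<dots> = (\<Sum>x\<in>?D. h x)"
    by (rule sum.group) auto
  also have "\<dots> = (\<Sum>i\<le>r. \<Sum>j\<le>r. sym_matrix r Q $$ (i, j) * (Poly_Mapping.lookup z i * Poly_Mapping.lookup z j))"
    by (simp add: sum.cartesian_product h_def case_prod_unfold)
  finally show ?thesis .
qed

section \<open>Numbering of the coordinates by index pairs\<close>

lemma set_index_pairs: "set (index_pairs n) = {(i, j). i \<le> j \<and> j \<le> n}"
proof -
  have "set (index_pairs n) = (\<Union>i\<in>{0..<Suc n}. Pair i ` {i..<Suc n})"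
    by (simp add: index_pairs_def del: upt_Suc)
  also have "\<dots> = (SIGMA i:{0..<Suc n}. {i..<Suc n})"
    by (simp only: Sigma_def UNION_singleton_eq_range)
  also have "\<dots> = {(i, j). i \<le> j \<and> j \<le> n}"
    by auto
  finally show ?thesis .
qed

text \<open>By counting: the set of listed pairs has as many elements as the list has
  entries.\<close>

lemma distinct_index_pairs: "distinct (index_pairs n)"
proof -
  have "set (index_pairs n) = (SIGMA i:{..n}. {i..n})"
    by (auto simp: set_index_pairs)
  then have "card (set (index_pairs n)) = (\<Sum>i\<le>n. Suc n - i)"
    by simp
  also have "\<dots> = length (index_pairs n)"
    by (simp add: index_pairs_def length_concat comp_def sum_list_distinct_conv_sum_set
        atLeast0LessThan lessThan_Suc_atMost del: upt_Suc)
  finally show ?thesis by (rule card_distinct)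
qed

text \<open>The index of the coordinate \<open>x\<^sub>i x\<^sub>j\<close>; unspecified unless \<open>i, j \<le> n\<close>.\<close>

definition pos :: "nat \<Rightarrow> nat \<Rightarrow> nat \<Rightarrow> nat" where
  "pos n i j = (SOME k. k < length (index_pairs n) \<and> index_pairs n ! k = (min i j, max i j))"

lemma pos:
  assumes "i \<le> n" "j \<le> n"
  shows "pos n i j < length (index_pairs n)" "index_pairs n ! pos n i j = (min i j, max i j)"
proof -
  have "(min i j, max i j) \<in> set (index_pairs n)"
    using assms by (auto simp: set_index_pairs)
  then have "\<exists>k. k < length (index_pairs n) \<and> index_pairs n ! k = (min i j, max i j)"
    by (simp add: in_set_conv_nth)
  from someI_ex[OF this] show "pos n i j < length (index_pairs n)"
    "index_pairs n ! pos n i j = (min i j, max i j)"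
    unfolding pos_def by auto
qed

lemma pos_commute: "pos n i j = pos n j i"
  by (simp add: pos_def min.commute max.commute)

lemma pos_eq_iff:
  assumes "i \<le> n" "j \<le> n" "k \<le> n" "l \<le> n"
  shows "pos n i j = pos n k l \<longleftrightarrow> i = k \<and> j = l \<or> i = l \<and> j = k"
proof
  assume "pos n i j = pos n k l"
  then have "(min i j, max i j) = (min k l, max k l)"
    using pos(2) assms by metis
  then show "i = k \<and> j = l \<or> i = l \<and> j = k"
    by (auto simp: min_def max_def split: if_splits)
qed (auto simp: pos_commute)

lemma posE:
  assumes "k < length (index_pairs n)"
  obtains i j where "i \<le> j" "j \<le> n" "k = pos n i j"
proof -
  obtain i j where ij: "index_pairs n ! k = (i, j)" by fastforce
  then have "i \<le> j" "j \<le> n"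
    using nth_mem[OF assms] by (auto simp: set_index_pairs)
  moreover from this have "k = pos n i j"
    using pos[of i n j] ij assms distinct_index_pairs[of n]
    by (metis le_trans max_def min_def nth_eq_iff_index_eq)
  ultimately show ?thesis by (rule that)
qed

lemma lookup_sum_pm: "Poly_Mapping.lookup (sum f S) k = (\<Sum>a\<in>S. Poly_Mapping.lookup (f a) k)"
  by (induction S rule: infinite_finite_induct) (simp_all add: lookup_add)

lemma lookup_sum_single:
  "Poly_Mapping.lookup (\<Sum>i\<le>n. Poly_Mapping.single i (f i)) k = (if k \<le> n then f k else 0)" for n :: nat
  by (simp add: lookup_sum_pm lookup_single when_def)

lemma pscale_single: "pscale c (Poly_Mapping.single m d) = Poly_Mapping.single m (c * d)"
  by (rule poly_mapping_eqI) (simp add: lookup_single when_def)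

lemma sum_single_lookup: "(\<Sum>m\<in>Poly_Mapping.keys p. Poly_Mapping.single m (Poly_Mapping.lookup p m)) = p"
  by (rule poly_mapping_eqI) (simp add: lookup_sum_pm lookup_single when_def in_keys_iff)

lemma lookup_veronese_vec:
  assumes "i \<le> n" "j \<le> n"
  shows "Poly_Mapping.lookup (veronese_vec n x) (pos n i j) = Poly_Mapping.lookup x i * Poly_Mapping.lookup x j"
proof -
  have "Poly_Mapping.lookup (veronese_vec n x) (pos n i j) =
    (\<Sum>k<length (index_pairs n). if k = pos n i j then
      (case index_pairs n ! k of (i, j) \<Rightarrow> Poly_Mapping.lookup x i * Poly_Mapping.lookup x j) else 0)"
    unfolding veronese_vec_def lookup_sum_pm
    by (intro sum.cong) (auto simp: lookup_single when_def split: prod.splits)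
  also have "\<dots> = Poly_Mapping.lookup x i * Poly_Mapping.lookup x j"
    using pos[OF assms] by (simp add: min_def max_def mult.commute)
  finally show ?thesis .
qed

lemma lookup_veronese_vec_ge:
  assumes "k \<ge> length (index_pairs n)"
  shows "Poly_Mapping.lookup (veronese_vec n x) k = 0"
  unfolding veronese_vec_def lookup_sum_pm using assms
  by (intro sum.neutral) (auto simp: lookup_single when_def split: prod.splits)

section \<open>Weights and the ideal of the Veronese variety\<close>

definition zmon :: "nat \<Rightarrow> nat \<Rightarrow> nat \<Rightarrow> nat \<Rightarrow> nat \<Rightarrow> monomial" where
  "zmon n i j k l = var (pos n i j) + var (pos n k l)"

text \<open>The monomial in \<open>x\<^sub>0, \<dots>, x\<^sub>n\<close> that a monomial of degree 2 in the coordinates of the Veronese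
  embedding induces; unspecified on all other monomials.\<close>

definition weight :: "nat \<Rightarrow> monomial \<Rightarrow> monomial" where
  "weight n m = (SOME w. \<exists>i\<le>n. \<exists>j\<le>n. \<exists>k\<le>n. \<exists>l\<le>n.
     m = zmon n i j k l \<and> w = var i + var j + var k + var l)"

text \<open>The description of a monomial as \<open>zmon\<close> is unique up to exchanging the two
  pairs and the indices within a pair, and the induced monomial is unaffected by this.\<close>

lemma weight_zmon:
  assumes "i \<le> n" "j \<le> n" "k \<le> n" "l \<le> n"
  shows "weight n (zmon n i j k l) = var i + var j + var k + var l"
  unfolding weight_def
proof (rule some_equality)
  show "\<exists>i'\<le>n. \<exists>j'\<le>n. \<exists>k'\<le>n. \<exists>l'\<le>n. zmon n i j k l = zmon n i' j' k' l' \<and>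
    var i + var j + var k + var l = var i' + var j' + var k' + var l'"
    using assms by blast
next
  fix w
  assume "\<exists>i'\<le>n. \<exists>j'\<le>n. \<exists>k'\<le>n. \<exists>l'\<le>n. zmon n i j k l = zmon n i' j' k' l' \<and>
    w = var i' + var j' + var k' + var l'"
  then obtain i' j' k' l' where *: "i' \<le> n" "j' \<le> n" "k' \<le> n" "l' \<le> n"
    "zmon n i j k l = zmon n i' j' k' l'" "w = var i' + var j' + var k' + var l'"
    by blast
  then have "pos n i j = pos n i' j' \<and> pos n k l = pos n k' l' \<or>
    pos n i j = pos n k' l' \<and> pos n k l = pos n i' j'"
    by (simp add: zmon_def var_add_eq_iff)
  then have "(var i + var j = var i' + var j' \<and> var k + var l = var k' + var l') \<or>
    (var i + var j = var k' + var l' \<and> var k + var l = var i' + var j')"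
    using * assms by (simp add: pos_eq_iff var_add_eq_iff)
  then have "(var i + var j) + (var k + var l) = (var i' + var j') + (var k' + var l')"
    by (metis add.commute)
  then show "w = var i + var j + var k + var l"
    unfolding *(6) by (simp only: add.assoc)
qed

lemma keys_quadratic_forms:
  assumes "Suc r = length (index_pairs n)" "Q \<in> quadratic_forms r" "m \<in> Poly_Mapping.keys Q"
  obtains i j k l where "i \<le> n" "j \<le> n" "k \<le> n" "l \<le> n" "m = zmon n i j k l"
proof -
  obtain p q where pq: "p \<le> r" "q \<le> r" "m = var p + var q"
    by (rule quadratic_formsE[OF assms(2,3)])
  have "p < length (index_pairs n)" "q < length (index_pairs n)"
    using pq(1,2) assms(1) by linarith+
  then obtain i j k l where "i \<le> j" "j \<le> n" "p = pos n i j" "k \<le> l" "l \<le> n" "q = pos n k l"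
    by (metis posE)
  then show ?thesis
    using that[of i j k l] pq(3) by (simp add: zmon_def)
qed

lemma pos_le:
  assumes "Suc r = length (index_pairs n)" "i \<le> n" "j \<le> n"
  shows "pos n i j \<le> r"
  using pos(1)[OF assms(2,3)] assms(1) by simp

section \<open>Vanishing on the points of the Veronese variety\<close>

lemma eval_poly_pscale:
  assumes "Q \<in> quadratic_forms r"
  shows "eval_poly Q (pscale c z) = c\<^sup>2 * eval_poly Q z"
  unfolding eval_poly_mon_eval sum_distrib_left
proof (rule sum.cong[OF refl])
  fix m assume m: "m \<in> Poly_Mapping.keys Q"
  obtain p q where "m = var p + var q"
    by (rule quadratic_formsE[OF assms m])
  then show "Poly_Mapping.lookup Q m * mon_eval m (Poly_Mapping.lookup (pscale c z)) =
    c\<^sup>2 * (Poly_Mapping.lookup Q m * mon_eval m (Poly_Mapping.lookup z))"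
    by (simp add: mon_eval_add power2_eq_square)
qed

text \<open>The map is homogeneous of degree 2 and depends only on the coordinates up to
  \<open>n\<close>. The case \<open>c = 1\<close> serves to truncate a vector, the case
  \<open>c = 0\<close> to treat a vector whose relevant coordinates vanish.\<close>

lemma veronese_vec_eqI:
  assumes "\<And>i. i \<le> n \<Longrightarrow> Poly_Mapping.lookup x i = c * Poly_Mapping.lookup y i"
  shows "veronese_vec n x = pscale (c\<^sup>2) (veronese_vec n y)"
proof (rule poly_mapping_eqI)
  fix k
  show "Poly_Mapping.lookup (veronese_vec n x) k = Poly_Mapping.lookup (pscale (c\<^sup>2) (veronese_vec n y)) k"
  proof (cases "k < length (index_pairs n)")
    case True
    then obtain i j where "i \<le> j" "j \<le> n" "k = pos n i j" by (rule posE)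
    then show ?thesis
      by (simp add: lookup_veronese_vec assms power2_eq_square)
  next
    case False
    then show ?thesis
      by (simp add: lookup_veronese_vec_ge)
  qed
qed

lemma pm_dim_singleton: "x \<noteq> 0 \<Longrightarrow> pm.dim (pm.span {x}) = 1"
  using pm.dim_span_eq_card_independent[of "{x}"] by (simp add: pm.dependent_single)

lemma span_singleton_proj:
  assumes "pm.subspace V" "x \<in> V" "x \<noteq> 0"
  shows "pm.span {x} \<in> proj V"
  unfolding proj_def using assms pm_dim_singleton[OF assms(3)] pm.span_minimal[of "{x}" V] by auto

lemma projE:
  assumes "L \<in> proj V"
  obtains x where "L = pm.span {x}" "x \<in> V"
proof -
  have L: "pm.subspace L" "L \<subseteq> V" "pm.dim L = 1"
    using assms by (auto simp: proj_def)
  obtain B where B: "B \<subseteq> L" "L \<subseteq> pm.span B" "card B = pm.dim L"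
    using pm.basis_exists by metis
  obtain x where "B = {x}"
    using B(3) L(3) card_1_singletonE by metis
  then have "L = pm.span {x}" "x \<in> V"
    using B L pm.span_minimal[of B L] by auto
  then show ?thesis by (rule that)
qed

lemma subspace_coord_space: "pm.subspace (coord_space N)"
  unfolding pm.subspace_def coord_space_def
  by (auto simp: in_keys_iff lookup_add dest: Poly_Mapping.keys_add[THEN subsetD])

text \<open>By homogeneity, vanishing on a point of the variety amounts to vanishing at one vector
  that spans it; so membership can be tested on all vectors \<open>x\<close>, zero included.\<close>

lemma ideal2_veronese:
  "Q \<in> ideal2 r (veronese_variety n) \<longleftrightarrow>
    Q \<in> quadratic_forms r \<and> (\<forall>x. eval_poly Q (veronese_vec n x) = 0)" (is "?l \<longleftrightarrow> ?r")
proof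
  assume ?l
  then have Q: "Q \<in> quadratic_forms r"
    and van: "\<And>L z. L \<in> veronese_variety n \<Longrightarrow> z \<in> L \<Longrightarrow> eval_poly Q z = 0"
    by (auto simp: ideal2_def)
  have "eval_poly Q (veronese_vec n x) = 0" for x
  proof -
    \<comment> \<open>Truncation puts the vector into \<open>coord_space (n + 1)\<close> without
      changing its image.\<close>
    define x' where "x' = (\<Sum>i\<le>n. Poly_Mapping.single i (Poly_Mapping.lookup x i))"
    have lookup: "Poly_Mapping.lookup x' i = (if i \<le> n then Poly_Mapping.lookup x i else 0)" for i
      unfolding x'_def by (rule lookup_sum_single)
    have eq: "veronese_vec n x = pscale (1\<^sup>2) (veronese_vec n x')"
      by (rule veronese_vec_eqI) (simp add: lookup)
    show ?thesis
    proof (cases "x' = 0")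
      case True
      then have "veronese_vec n x = pscale (0\<^sup>2) (veronese_vec n x)"
        using lookup by (intro veronese_vec_eqI) (metis lookup_zero mult_zero_left)
      then have "eval_poly Q (veronese_vec n x) = (0\<^sup>2)\<^sup>2 * eval_poly Q (veronese_vec n x)"
        using eval_poly_pscale[OF Q] by metis
      then show ?thesis by simp
    next
      case False
      have "x' \<in> coord_space (n + 1)"
        by (auto simp: coord_space_def in_keys_iff lookup split: if_splits)
      then have "pm.span {x'} \<in> proj (coord_space (n + 1))"
        by (rule span_singleton_proj[OF subspace_coord_space _ False])
      then have "veronese n (pm.span {x'}) \<in> veronese_variety n"
        by (simp add: veronese_variety_def)
      moreover have "veronese_vec n x' \<in> veronese n (pm.span {x'})"
        unfolding veronese_def by (intro pm.span_base imageI) simp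
      ultimately show ?thesis
        using van eq by simp
    qed
  qed
  with Q show ?r by blast
next
  assume r: ?r
  have "eval_poly Q z = 0" if L: "L \<in> veronese_variety n" and z: "z \<in> L" for L z
  proof -
    obtain L0 where L0: "L0 \<in> proj (coord_space (n + 1))" "L = veronese n L0"
      using L unfolding veronese_variety_def by blast
    obtain x where x: "L0 = pm.span {x}"
      using projE[OF L0(1)] by blast
    have "veronese_vec n ` L0 \<subseteq> pm.span {veronese_vec n x}"
    proof
      fix y assume "y \<in> veronese_vec n ` L0"
      then obtain c where "y = veronese_vec n (pscale c x)"
        by (auto simp: x pm.span_singleton)
      also have "\<dots> = pscale (c\<^sup>2) (veronese_vec n x)"
        by (rule veronese_vec_eqI) simp
      finally show "y \<in> pm.span {veronese_vec n x}"
        by (auto simp: pm.span_singleton)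
    qed
    then have "L \<subseteq> pm.span {veronese_vec n x}"
      unfolding L0(2) veronese_def by (intro pm.span_minimal) auto
    then obtain c where "z = pscale c (veronese_vec n x)"
      using z by (auto simp: pm.span_singleton)
    then show ?thesis
      using r eval_poly_pscale[of Q r] by auto
  qed
  then show ?l
    using r by (auto simp: ideal2_def)
qed

lemma mon_eval_zmon:
  assumes "i \<le> n" "j \<le> n" "k \<le> n" "l \<le> n"
  shows "mon_eval (zmon n i j k l) (Poly_Mapping.lookup (veronese_vec n x)) =
    mon_eval (var i + var j + var k + var l) (Poly_Mapping.lookup x)"
  using assms by (simp add: zmon_def mon_eval_add lookup_veronese_vec)

text \<open>The sum is the coefficient of \<open>w\<close> in the polynomial that \<open>Q\<close>
  becomes under the Veronese map. This polynomial vanishes everywhere, and monomials are linearly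
  independent as functions.\<close>

lemma ideal2_weight_sum:
  fixes Q :: "'a::alg_closed_field mpoly"
  assumes r: "Suc r = length (index_pairs n)" and Q: "Q \<in> ideal2 r (veronese_variety n)"
  shows "(\<Sum>m | m \<in> Poly_Mapping.keys Q \<and> weight n m = w. Poly_Mapping.lookup Q m) = 0"
proof -
  have quad: "Q \<in> quadratic_forms r" and van: "\<And>x. eval_poly Q (veronese_vec n x) = 0"
    using Q unfolding ideal2_veronese by auto
  let ?K = "Poly_Mapping.keys Q"
  define u where "u = (\<lambda>w. \<Sum>m | m \<in> ?K \<and> weight n m = w. Poly_Mapping.lookup Q m)"
  have "(\<Sum>w\<in>weight n ` ?K. u w * mon_eval w x) = 0" for x
  proof -
    define x' where "x' = (\<Sum>i\<le>n. Poly_Mapping.single i (x i))"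
    have x': "Poly_Mapping.lookup x' i = x i" if "i \<le> n" for i
      unfolding x'_def using that by (simp add: lookup_sum_single)
    have "(\<Sum>w\<in>weight n ` ?K. u w * mon_eval w x) =
      (\<Sum>w\<in>weight n ` ?K. \<Sum>m | m \<in> ?K \<and> weight n m = w. Poly_Mapping.lookup Q m * mon_eval (weight n m) x)"
      unfolding u_def sum_distrib_right by (intro sum.cong) auto
    also have "\<dots> = (\<Sum>m\<in>?K. Poly_Mapping.lookup Q m * mon_eval (weight n m) x)"
      by (rule sum.group) auto
    also have "\<dots> = eval_poly Q (veronese_vec n x')"
      unfolding eval_poly_mon_eval
    proof (rule sum.cong[OF refl])
      fix m assume m: "m \<in> ?K"
      obtain i j k l where ijkl: "i \<le> n" "j \<le> n" "k \<le> n" "l \<le> n" "m = zmon n i j k l"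
        by (rule keys_quadratic_forms[OF r quad m])
      show "Poly_Mapping.lookup Q m * mon_eval (weight n m) x =
        Poly_Mapping.lookup Q m * mon_eval m (Poly_Mapping.lookup (veronese_vec n x'))"
        unfolding ijkl(5) mon_eval_zmon[OF ijkl(1-4)] weight_zmon[OF ijkl(1-4)]
        using ijkl(1-4) by (simp add: mon_eval_add x')
    qed
    finally show ?thesis by (simp add: van)
  qed
  then have "u w = 0" if "w \<in> weight n ` ?K"
    using mon_eval_independent[OF alg_closed_infinite _ _ that, of u] by simp
  moreover have "u w = 0" if "w \<notin> weight n ` ?K"
    unfolding u_def using that by (intro sum.neutral) auto
  ultimately show ?thesis
    unfolding u_def by blast
qed

section \<open>Quadrics \<open>AC - B\<^sup>2\<close> of rank 3\<close>

definition linear_form :: "nat \<Rightarrow> (nat \<Rightarrow> 'a::field) \<Rightarrow> 'a mpoly" where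
  "linear_form r f = (\<Sum>k\<le>r. Poly_Mapping.single (var k) (f k))"

lemma linear_form_mult:
  "linear_form r f * linear_form r g = (\<Sum>k\<le>r. \<Sum>l\<le>r. Poly_Mapping.single (var k + var l) (f k * g l))"
  by (simp add: linear_form_def sum_product mult_single)

lemma subspace_quadratic_forms: "pm.subspace (quadratic_forms r)"
  unfolding pm.subspace_def quadratic_forms_def
  by (auto simp: in_keys_iff lookup_add dest: Poly_Mapping.keys_add[THEN subsetD])

lemma single_quadratic_forms:
  assumes "p \<le> r" "q \<le> r"
  shows "Poly_Mapping.single (var p + var q) c \<in> quadratic_forms r"
  using assms by (auto simp: quadratic_forms_def mon_degree_add split: if_splits)

lemma linear_form_mult_quadratic_forms: "linear_form r f * linear_form r g \<in> quadratic_forms r"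
  unfolding linear_form_mult
  by (intro pm.subspace_sum[OF subspace_quadratic_forms] single_quadratic_forms) auto

lemma lookup_linear_form_mult:
  assumes "p \<le> r" "q \<le> r"
  shows "Poly_Mapping.lookup (linear_form r f * linear_form r g) (var p + var q) =
    (if p = q then f p * g p else f p * g q + f q * g p)"
proof -
  have "Poly_Mapping.lookup (linear_form r f * linear_form r g) (var p + var q) =
    (\<Sum>x\<in>{..r} \<times> {..r}. if var (fst x) + var (snd x) = var p + var q then f (fst x) * g (snd x) else 0)"
    unfolding linear_form_mult lookup_sum_pm sum.cartesian_product
    by (intro sum.cong) (auto simp: lookup_single when_def)
  also have "\<dots> = (\<Sum>x\<in>{(p, q), (q, p)}. f (fst x) * g (snd x))"
    using assms by (intro sum.mono_neutral_cong_right) (auto simp: var_add_eq_iff)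
  also have "\<dots> = (if p = q then f p * g p else f p * g q + f q * g p)"
    by simp
  finally show ?thesis .
qed

definition conic :: "nat \<Rightarrow> (nat \<Rightarrow> 'a) \<Rightarrow> (nat \<Rightarrow> 'a) \<Rightarrow> (nat \<Rightarrow> 'a) \<Rightarrow> 'a::field mpoly" where
  "conic r a b c = linear_form r a * linear_form r c - linear_form r b * linear_form r b"

lemma conic_quadratic_forms: "conic r a b c \<in> quadratic_forms r"
  unfolding conic_def
  by (intro pm.subspace_diff[OF subspace_quadratic_forms] linear_form_mult_quadratic_forms)

lemma sym_matrix_conic:
  fixes a b c :: "nat \<Rightarrow> 'a::field"
  assumes "p < r + 1" "q < r + 1" "(2::'a) \<noteq> 0"
  shows "sym_matrix r (conic r a b c) $$ (p, q) = (a p * c q + a q * c p) / 2 - b p * b q"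
proof -
  have "p \<le> r" "q \<le> r" using assms by auto
  note lookup = lookup_linear_form_mult[OF this]
  show ?thesis
  proof (cases "p = q")
    case True
    have "a p * c p + a p * c p = 2 * (a p * c p)"
      by (rule mult_2[symmetric])
    with True show ?thesis
      using assms by (simp add: sym_matrix_index conic_def lookup_minus lookup_linear_form_mult)
  next
    case False
    with assms show ?thesis
      by (simp add: sym_matrix_index conic_def lookup_minus lookup field_simps)
  qed
qed

text \<open>Formulated for the matrix instead of \<open>conic\<close>, because it is also applied to
  a given quadric of rank 3 whose matrix has been brought into this form.\<close>

lemma sum_conic_matrix:
  fixes a b c z :: "nat \<Rightarrow> 'a::field"
  assumes "(2::'a) \<noteq> 0"
  shows "(\<Sum>i\<le>r. \<Sum>j\<le>r. ((a i * c j + a j * c i) / 2 - b i * b j) * (z i * z j)) =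
    (\<Sum>i\<le>r. a i * z i) * (\<Sum>i\<le>r. c i * z i) - (\<Sum>i\<le>r. b i * z i)\<^sup>2"
proof -
  let ?S = "\<lambda>f g. \<Sum>i\<le>r. \<Sum>j\<le>r. (f i * z i) * (g j * z j)"
  have S: "?S f g = (\<Sum>i\<le>r. f i * z i) * (\<Sum>i\<le>r. g i * z i)" for f g
    by (simp add: sum_product)
  have "(\<Sum>i\<le>r. \<Sum>j\<le>r. ((a i * c j + a j * c i) / 2 - b i * b j) * (z i * z j)) =
    (?S a c + ?S c a) / 2 - ?S b b"
    unfolding sum.distrib[symmetric] sum_subtractf[symmetric] sum_divide_distrib
    by (intro sum.cong refl) (simp add: field_simps assms)
  also have "?S c a = ?S a c"
    unfolding S by (rule mult.commute)
  also have "(?S a c + ?S a c) / 2 = ?S a c"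
    unfolding mult_2[symmetric] using assms by simp
  finally show ?thesis
    unfolding S power2_eq_square .
qed

lemma eval_poly_conic:
  fixes a b c :: "nat \<Rightarrow> 'a::field"
  assumes "(2::'a) \<noteq> 0"
  shows "eval_poly (conic r a b c) z = (\<Sum>p\<le>r. a p * Poly_Mapping.lookup z p) *
    (\<Sum>p\<le>r. c p * Poly_Mapping.lookup z p) - (\<Sum>p\<le>r. b p * Poly_Mapping.lookup z p)\<^sup>2"
  unfolding eval_poly_sym_matrix[OF conic_quadratic_forms assms] sum_conic_matrix[OF assms, symmetric]
  by (intro sum.cong refl) (simp add: sym_matrix_conic[OF _ _ assms])

text \<open>The three products bound the rank from above. If the rank were at most 2, the matrix
  would be the Gram matrix of vectors in a plane; but the vectors for \<open>p\<close> and
  \<open>q\<close> would form a basis of it, and the vector for \<open>w\<close> would be orthogonal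
  to both without being isotropic.\<close>

lemma quadric_rank_conic:
  fixes a b c :: "nat \<Rightarrow> 'a::alg_closed_field"
  assumes two: "(2::'a) \<noteq> 0" and pqw: "p \<le> r" "q \<le> r" "w \<le> r"
    and p: "a p = 1" "b p = 0" "c p = 0"
    and q: "a q = 0" "b q = 0" "c q = 1"
    and w: "a w = 0" "b w = 1" "c w = 0"
  shows "quadric_rank r (conic r a b c) = 3"
proof -
  let ?M = "sym_matrix r (conic r a b c)"
  let ?R = "vec_space.rank (r + 1) ?M"
  note M = sym_matrix_conic[OF _ _ two]
  define f g where "f = (\<lambda>k. [\<lambda>i. a i / 2, \<lambda>i. c i / 2, \<lambda>i. - b i] ! k)"
    and "g = (\<lambda>k. [c, a, b] ! k)"
  have "?R \<le> 3"
    by (rule rank_sum_of_products[where f = f and g = g])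
       (simp_all add: sym_matrix_carrier[simplified] M f_def g_def numeral_3_eq_3 add_divide_distrib mult.commute)
  moreover have "\<not> ?R \<le> 2"
  proof
    assume le: "?R \<le> 2"
    obtain h where h: "\<And>i j. i < r + 1 \<Longrightarrow> j < r + 1 \<Longrightarrow> ?M $$ (i, j) = (\<Sum>k<?R. h k i * h k j)"
      using symmetric_mat_sum_of_squares[OF sym_matrix_carrier two sym_matrix_sym] by metis
    \<comment> \<open>Missing squares are replaced by 0, so that there are always exactly
      two.\<close>
    define u v where "u = (\<lambda>i. if 0 < ?R then h 0 i else 0)" and "v = (\<lambda>i. if 1 < ?R then h 1 i else 0)"
    have uv: "u i * u j + v i * v j = (a i * c j + a j * c i) / 2 - b i * b j"
      if "i < r + 1" "j < r + 1" for i j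
    proof -
      have "(\<Sum>k<?R. h k i * h k j) = u i * u j + v i * v j"
        using le by (cases ?R; cases "?R - 1") (auto simp: u_def v_def)
      then show ?thesis
        using h[OF that] M[OF that] by simp
    qed
    have lt: "p < r + 1" "q < r + 1" "w < r + 1" using pqw by auto
    have eqs: "u p * u p + v p * v p = 0" "u q * u q + v q * v q = 0" "u p * u q + v p * v q = 1 / 2"
      "u p * u w + v p * v w = 0" "u q * u w + v q * v w = 0" "u w * u w + v w * v w = -1"
      using uv[OF lt(1) lt(1)] uv[OF lt(2) lt(2)] uv[OF lt(1) lt(2)] uv[OF lt(1) lt(3)]
        uv[OF lt(2) lt(3)] uv[OF lt(3) lt(3)] by (simp_all add: p q w)
    \<comment> \<open>The determinant of the vectors for \<open>p\<close> and \<open>q\<close>; its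
      square is their Gram determinant, here \<open>-1/4\<close>.\<close>
    define \<delta> where "\<delta> = u p * v q - u q * v p"
    have "\<delta> * \<delta> + (u p * u q + v p * v q) * (u p * u q + v p * v q) =
      (u p * u p + v p * v p) * (u q * u q + v q * v q)"
      by (simp add: \<delta>_def algebra_simps)
    then have "\<delta> * \<delta> + 1 / 2 * (1 / 2) = 0"
      by (simp only: eqs mult_zero_left)
    moreover have "1 / 2 * (1 / 2) \<noteq> (0::'a)"
      unfolding mult_eq_0_iff divide_eq_0_iff using two by simp
    ultimately have "\<delta> \<noteq> 0"
      by (metis add_0 mult_zero_left)
    \<comment> \<open>Cramer's rule for the vector for \<open>w\<close>.\<close>
    have "\<delta> * u w = (u p * u w + v p * v w) * v q - (u q * u w + v q * v w) * v p"
      "\<delta> * v w = u p * (u q * u w + v q * v w) - u q * (u p * u w + v p * v w)"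
      by (simp_all add: \<delta>_def algebra_simps)
    then have "\<delta> * u w = 0" "\<delta> * v w = 0"
      by (simp_all only: eqs mult_zero_left mult_zero_right diff_zero)
    then have "u w = 0" "v w = 0"
      using \<open>\<delta> \<noteq> 0\<close> by auto
    then show False
      using eqs(6) by simp
  qed
  ultimately show ?thesis
    by (simp add: quadric_rank_def)
qed

section \<open>Products of binomial linear forms and the generating quadrics\<close>

lemma linear_form_add: "linear_form r (\<lambda>k. f k + g k) = linear_form r f + linear_form r g"
  by (simp add: linear_form_def single_add sum.distrib)

lemma linear_form_scale: "linear_form r (\<lambda>k. c * f k) = pscale c (linear_form r f)"
  unfolding linear_form_def pm.scale_sum_right
  by (intro sum.cong poly_mapping_eqI refl) (simp add: lookup_single when_def)

lemma linear_form_delta: "p \<le> r \<Longrightarrow> linear_form r (\<lambda>k. of_bool (k = p)) = Poly_Mapping.single (var p) 1"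
  unfolding linear_form_def by (subst sum.remove[of _ p]) (auto intro!: sum.neutral)

lemma sum_of_bool_mult: "p \<le> r \<Longrightarrow> (\<Sum>k\<le>(r::nat). of_bool (k = p) * z k) = (z p :: 'a::field)"
  by (subst sum.remove[of _ p]) (auto intro!: sum.neutral)

text \<open>The product of the linear forms \<open>x\<^sub>i + e x\<^sub>k\<close> and \<open>x\<^sub>j + h x\<^sub>l\<close>, as a linear form in the
  coordinates of the Veronese embedding.\<close>

definition prod_form :: "nat \<Rightarrow> nat \<Rightarrow> nat \<Rightarrow> 'a \<Rightarrow> nat \<Rightarrow> nat \<Rightarrow> 'a \<Rightarrow> nat \<Rightarrow> 'a::field" where
  "prod_form n i k e j l h p = of_bool (p = pos n i j) + h * of_bool (p = pos n i l)
    + (e * of_bool (p = pos n k j) + e * h * of_bool (p = pos n k l))"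

lemma sum_prod_form:
  assumes r: "Suc r = length (index_pairs n)" and "i \<le> n" "j \<le> n" "k \<le> n" "l \<le> n"
  shows "(\<Sum>p\<le>r. prod_form n i k e j l h p * Poly_Mapping.lookup (veronese_vec n x) p) =
    (Poly_Mapping.lookup x i + e * Poly_Mapping.lookup x k) *
    (Poly_Mapping.lookup x j + h * Poly_Mapping.lookup x l)"
proof -
  note le = pos_le[OF r]
  show ?thesis
    unfolding prod_form_def distrib_right sum.distrib mult.assoc sum_distrib_left[symmetric]
    using assms by (simp add: sum_of_bool_mult le lookup_veronese_vec algebra_simps)
qed

text \<open>The quadric \<open>[s\<^sup>2][t\<^sup>2] - [st]\<^sup>2\<close> for \<open>s = x\<^sub>i + e x\<^sub>k\<close> and \<open>t = x\<^sub>j + h x\<^sub>l\<close>.\<close>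

definition gen :: "nat \<Rightarrow> nat \<Rightarrow> nat \<Rightarrow> nat \<Rightarrow> 'a \<Rightarrow> nat \<Rightarrow> nat \<Rightarrow> 'a \<Rightarrow> 'a::field mpoly" where
  "gen r n i k e j l h =
    conic r (prod_form n i k e i k e) (prod_form n i k e j l h) (prod_form n j l h j l h)"

lemma gen_ideal2:
  assumes "Suc r = length (index_pairs n)" "i \<le> n" "j \<le> n" "k \<le> n" "l \<le> n" "(2::'a::field) \<noteq> 0"
  shows "gen r n i k e j l (h::'a) \<in> ideal2 r (veronese_variety n)"
  unfolding ideal2_veronese gen_def
  using assms by (simp add: conic_quadratic_forms eval_poly_conic sum_prod_form power2_eq_square)

text \<open>As \<open>s\<close> and \<open>t\<close> have no variable in common, the coordinates
  \<open>x_i^2\<close>, \<open>x_j^2\<close> and \<open>x_i x_j\<close> separate \<open>s^2\<close>,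
  \<open>t^2\<close> and \<open>st\<close>. Taking \<open>k = i\<close> with \<open>e = 0\<close>
  covers \<open>s = x_i\<close>, and similarly for \<open>t\<close>.\<close>

lemma quadric_rank_gen:
  assumes r: "Suc r = length (index_pairs n)" and n: "i \<le> n" "j \<le> n" "k \<le> n" "l \<le> n"
    and two: "(2::'a::alg_closed_field) \<noteq> 0"
    and "i \<noteq> j" "i \<noteq> l" "k \<noteq> j" "k \<noteq> l" "k \<noteq> i \<or> e = 0" "l \<noteq> j \<or> h = 0"
  shows "quadric_rank r (gen r n i k e j l (h::'a)) = 3"
proof -
  have "pos n a b = pos n c d \<longleftrightarrow> a = c \<and> b = d \<or> a = d \<and> b = c"
    if "a \<in> {i, j, k, l}" "b \<in> {i, j, k, l}" "c \<in> {i, j, k, l}" "d \<in> {i, j, k, l}" for a b c d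
    using that n by (intro pos_eq_iff) auto
  then show ?thesis
    unfolding gen_def using assms
    by (intro quadric_rank_conic[OF two pos_le[OF r n(1,1)] pos_le[OF r n(2,2)] pos_le[OF r n(1,2)]])
       (auto simp: prod_form_def)
qed

lemma rank_quadricsI:
  fixes Q :: "'a::field mpoly"
  assumes "Q \<in> ideal2 r X" "quadric_rank r Q = d" "d > 0"
  shows "Q \<in> \<Union> (rank_quadrics d r X)"
proof -
  have "Q \<noteq> 0"
  proof
    assume "Q = 0"
    then have "sym_matrix r Q = 0\<^sub>m (r + 1) (r + 1)"
      by (intro eq_matI) (simp_all add: sym_matrix_def Let_def)
    then show False
      using assms(2,3) by (simp add: quadric_rank_def vec_space.rank_0I)
  qed
  then have "pm.span {Q} \<in> proj (ideal2 r X)"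
    using span_singleton_proj[OF subspace_ideal2 assms(1)] by blast
  then have "pm.span {Q} \<in> rank_quadrics d r X"
    using assms(2) by (auto simp: rank_quadrics_def)
  then show ?thesis
    by (meson UnionI pm.span_base singletonI)
qed

section \<open>Rank 3 quadrics in characteristic 3\<close>

text \<open>The symmetric matrix of the quadratic form in the \<open>x_i\<close> that the linear
  form with coefficients \<open>g\<close> induces; off the diagonal it is halved because
  \<open>bf\<close> counts mixed products twice.\<close>

definition form_mat :: "nat \<Rightarrow> (nat \<Rightarrow> 'a::field) \<Rightarrow> nat \<Rightarrow> nat \<Rightarrow> 'a" where
  "form_mat n g i j = (if i = j then 1 else 1 / 2) * g (pos n i j)"

lemma form_mat_sym: "form_mat n g i j = form_mat n g j i"
  by (simp add: form_mat_def pos_commute)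

lemma sum_veronese_vec:
  fixes g :: "nat \<Rightarrow> 'a::field"
  assumes r: "Suc r = length (index_pairs n)" and two: "(2::'a) \<noteq> 0"
  shows "(\<Sum>p\<le>r. g p * Poly_Mapping.lookup (veronese_vec n x) p) =
    bf n (form_mat n g) (Poly_Mapping.lookup x) (Poly_Mapping.lookup x)"
proof -
  define h where "h = (\<lambda>y. form_mat n g (fst y) (snd y) *
    Poly_Mapping.lookup x (fst y) * Poly_Mapping.lookup x (snd y))"
  define P where "P = (\<lambda>y. pos n (fst y) (snd y))"
  let ?D = "{..n} \<times> {..n}"
  have "(\<Sum>p\<le>r. g p * Poly_Mapping.lookup (veronese_vec n x) p) =
    (\<Sum>p\<le>r. \<Sum>y\<in>{y \<in> ?D. P y = p}. h y)"
  proof (rule sum.cong[OF refl])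
    fix p assume "p \<in> {..r}"
    then have "p < length (index_pairs n)" using r by simp
    then obtain i j where ij: "i \<le> j" "j \<le> n" "p = pos n i j" by (rule posE)
    then have le: "i \<le> n" by simp
    have eq: "{y \<in> ?D. P y = p} = {(i, j), (j, i)}"
      using ij(2,3) le by (auto simp: P_def pos_eq_iff)
    have v: "Poly_Mapping.lookup (veronese_vec n x) p = Poly_Mapping.lookup x i * Poly_Mapping.lookup x j"
      unfolding ij(3) by (rule lookup_veronese_vec[OF le ij(2)])
    show "g p * Poly_Mapping.lookup (veronese_vec n x) p = (\<Sum>y\<in>{y \<in> ?D. P y = p}. h y)"
    proof (cases "i = j")
      case True
      then show ?thesis
        unfolding eq v by (simp add: h_def form_mat_def ij(3))
    next
      case False
      have "h (j, i) = h (i, j)"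
        using form_mat_sym[of n g j i] by (simp add: h_def mult_ac)
      with False have "(\<Sum>y\<in>{y \<in> ?D. P y = p}. h y) = 2 * h (i, j)"
        unfolding eq by simp
      also have "\<dots> = g p * (Poly_Mapping.lookup x i * Poly_Mapping.lookup x j)"
        using False two by (simp add: h_def form_mat_def ij(3))
      finally show ?thesis
        unfolding v by simp
    qed
  qed
  also have "\<dots> = (\<Sum>y\<in>?D. h y)"
    using pos_le[OF r] by (intro sum.group) (auto simp: P_def)
  also have "\<dots> = bf n (form_mat n g) (Poly_Mapping.lookup x) (Poly_Mapping.lookup x)"
    by (simp add: bf_def sum.cartesian_product h_def case_prod_unfold)
  finally show ?thesis .
qed

definition unit_vector :: "nat \<Rightarrow> nat \<Rightarrow> 'a::zero_neq_one" where
  "unit_vector i k = of_bool (k = i)"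

lemma lf_unit_vector: "i \<le> n \<Longrightarrow> lf n s (unit_vector i) = s i"
  unfolding lf_def by (subst sum.remove[of _ i]) (auto simp: unit_vector_def intro!: sum.neutral)

lemma bf_unit_vector: "i \<le> n \<Longrightarrow> j \<le> n \<Longrightarrow> bf n f (unit_vector i) (unit_vector j) = f i j"
  by (simp add: bf_lf lf_unit_vector) (use lf_unit_vector[of j n "f i"] in \<open>simp add: lf_def\<close>)

text \<open>Expresses a mixed coefficient by values of the form, so that identities between
  quadratic forms as functions carry over to coefficients. The factor 1 matches the shape of
  \<open>bf_line\<close>.\<close>

lemma form_mat_polarization:
  fixes g :: "nat \<Rightarrow> 'a::field"
  assumes "i \<le> n" "j \<le> n" "i \<noteq> j" "(2::'a) \<noteq> 0"
  shows "g (pos n i j) = (let x = (\<lambda>k. unit_vector i k + 1 * unit_vector j k); q = (\<lambda>x. bf n (form_mat n g) x x)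
    in q x - q (unit_vector i) - q (unit_vector j))"
proof -
  have "2 * form_mat n g i j = g (pos n i j)"
    using assms(3,4) by (simp add: form_mat_def)
  then show ?thesis
    unfolding Let_def bf_line[of "form_mat n g", OF form_mat_sym] using assms(1,2) by (simp add: bf_unit_vector)
qed

lemma bf_cong:
  assumes "\<And>i. i \<le> n \<Longrightarrow> x i = x' i"
  shows "bf n f x x = bf n f x' x'"
  unfolding bf_def using assms by (intro sum.cong refl) auto

text \<open>If \<open>A\<close>, \<open>B\<close>, \<open>C\<close> are \<open>s^2\<close>,
  \<open>st\<close>, \<open>t^2\<close>, the two coefficients differ by 6 times a product of two
  minors of \<open>s\<close> and \<open>t\<close>, which is 0 as \<open>3 = 0\<close>. In the other
  two cases both coefficients vanish.\<close>

lemma rank_3_lookup_eq: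
  fixes Q :: "'a::alg_closed_field mpoly"
  assumes r: "Suc r = length (index_pairs n)" and Q: "Q \<in> ideal2 r (veronese_variety n)"
    and rank: "quadric_rank r Q = 3" and two: "(2::'a) \<noteq> 0" and three: "(3::'a) = 0"
    and n: "i \<le> n" "j \<le> n" "k \<le> n" "l \<le> n" and dist: "distinct [i, j, k, l]"
  shows "Poly_Mapping.lookup Q (zmon n i j k l) = Poly_Mapping.lookup Q (zmon n i k j l)"
proof -
  have quad: "Q \<in> quadratic_forms r" and van: "\<And>x. eval_poly Q (veronese_vec n x) = 0"
    using Q unfolding ideal2_veronese by auto
  let ?R = "vec_space.rank (r + 1) (sym_matrix r Q)"
  obtain f where "\<And>p q. p < r + 1 \<Longrightarrow> q < r + 1 \<Longrightarrow> sym_matrix r Q $$ (p, q) = (\<Sum>k<?R. f k p * f k q)"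
    using symmetric_mat_sum_of_squares[OF sym_matrix_carrier two sym_matrix_sym] by metis
  moreover have "?R = 3"
    using rank by (simp only: quadric_rank_def)
  ultimately have f: "\<And>p q. p < r + 1 \<Longrightarrow> q < r + 1 \<Longrightarrow> sym_matrix r Q $$ (p, q) = (\<Sum>k<3. f k p * f k q)"
    by simp
  \<comment> \<open>A sum of three squares becomes \<open>AC - B^2\<close>: the first two split into
    conjugate factors, and \<open>\<iota>\<close> turns the sign of the third.\<close>
  obtain \<iota> :: 'a where \<iota>: "\<iota>\<^sup>2 = -1" using sqrt_exists by blast
  define a b c where "a = (\<lambda>p. f 0 p + \<iota> * f 1 p)" and "b = (\<lambda>p. \<iota> * f 2 p)"
    and "c = (\<lambda>p. f 0 p - \<iota> * f 1 p)"
  have M: "sym_matrix r Q $$ (p, q) = (a p * c q + a q * c p) / 2 - b p * b q"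
    if "p < r + 1" "q < r + 1" for p q
  proof -
    have ac: "a p * c q + a q * c p = 2 * (f 0 p * f 0 q - \<iota>\<^sup>2 * (f 1 p * f 1 q))"
      by (simp add: a_def c_def algebra_simps power2_eq_square)
    have bb: "b p * b q = \<iota>\<^sup>2 * (f 2 p * f 2 q)"
      by (simp add: b_def algebra_simps power2_eq_square)
    show ?thesis
      unfolding f[OF that] ac bb \<iota> using two by (simp add: numeral_3_eq_3 numeral_2_eq_2)
  qed
  let ?A = "form_mat n a" and ?B = "form_mat n b" and ?C = "form_mat n c"
  have eq: "bf n ?A x x * bf n ?C x x = (bf n ?B x x)\<^sup>2" for x
  proof -
    define x' where "x' = (\<Sum>i\<le>n. Poly_Mapping.single i (x i))"
    have x': "x i = Poly_Mapping.lookup x' i" if "i \<le> n" for i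
      unfolding x'_def using that by (simp add: lookup_sum_single)
    have bf: "bf n f x x = bf n f (Poly_Mapping.lookup x') (Poly_Mapping.lookup x')" for f
      by (rule bf_cong) (rule x')
    let ?v = "Poly_Mapping.lookup (veronese_vec n x')"
    have "0 = (\<Sum>i\<le>r. \<Sum>j\<le>r. ((a i * c j + a j * c i) / 2 - b i * b j) * (?v i * ?v j))"
      unfolding van[of x', symmetric] eval_poly_sym_matrix[OF quad two]
      by (intro sum.cong refl) (simp add: M)
    also have "\<dots> = bf n ?A x x * bf n ?C x x - (bf n ?B x x)\<^sup>2"
      by (simp only: sum_conic_matrix[OF two] sum_veronese_vec[OF r two] bf)
    finally show ?thesis by simp
  qed
  note pol = form_mat_polarization[OF _ _ _ two, unfolded Let_def]
  have lookup: "Poly_Mapping.lookup Q (zmon n i j k l) =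
      a (pos n i j) * c (pos n k l) + a (pos n k l) * c (pos n i j) - 2 * (b (pos n i j) * b (pos n k l))"
    if "i \<le> n" "j \<le> n" "k \<le> n" "l \<le> n" "distinct [i, j, k, l]" for i j k l
  proof -
    have ne: "pos n i j \<noteq> pos n k l" and le: "pos n i j \<le> r" "pos n k l \<le> r"
      using that pos_eq_iff pos_le[OF r] by auto
    show ?thesis
      unfolding zmon_def lookup_sym_matrix[OF le ne two] using le two
      by (simp add: M right_diff_distrib)
  qed
  have lookups: "Poly_Mapping.lookup Q (zmon n i j k l) =
      a (pos n i j) * c (pos n k l) + a (pos n k l) * c (pos n i j) - 2 * (b (pos n i j) * b (pos n k l))"
    "Poly_Mapping.lookup Q (zmon n i k j l) =
      a (pos n i k) * c (pos n j l) + a (pos n j l) * c (pos n i k) - 2 * (b (pos n i k) * b (pos n j l))"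
    using n dist by (auto intro!: lookup)
  from form_mat_sym form_mat_sym form_mat_sym two eq show ?thesis
  proof (rule quadratic_forms_mult_eq_square)
    assume A: "\<And>x. bf n ?A x x = 0" and B: "\<And>x. bf n ?B x x = 0"
    have "a (pos n i j) = 0" "b (pos n i j) = 0" if "i \<le> n" "j \<le> n" "i \<noteq> j" for i j
      using pol[OF that, of a] pol[OF that, of b] by (simp_all only: A B diff_zero)
    then show ?thesis
      using n dist by (simp add: lookups)
  next
    fix \<beta>
    assume B: "\<And>x. bf n ?B x x = \<beta> * bf n ?A x x" and C: "\<And>x. bf n ?C x x = \<beta>\<^sup>2 * bf n ?A x x"
    have "b (pos n i j) = \<beta> * a (pos n i j)" "c (pos n i j) = \<beta>\<^sup>2 * a (pos n i j)"
      if "i \<le> n" "j \<le> n" "i \<noteq> j" for i j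
      using pol[OF that, of a] pol[OF that, of b] pol[OF that, of c]
      by (simp_all only: B C right_diff_distrib)
    then show ?thesis
      using n dist by (simp add: lookups power2_eq_square algebra_simps)
  next
    fix s t
    assume A: "\<And>x. bf n ?A x x = (lf n s x)\<^sup>2" and C: "\<And>x. bf n ?C x x = (lf n t x)\<^sup>2"
      and B: "\<And>x. bf n ?B x x = lf n s x * lf n t x"
    have "a (pos n i j) = 2 * (s i * s j)" "b (pos n i j) = s i * t j + s j * t i"
      "c (pos n i j) = 2 * (t i * t j)" if "i \<le> n" "j \<le> n" "i \<noteq> j" for i j
      unfolding pol[OF that, of a] pol[OF that, of b] pol[OF that, of c] A B C lf_line
        lf_unit_vector[OF that(1)] lf_unit_vector[OF that(2)]
      by (simp_all add: power2_eq_square algebra_simps)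
    then have "Poly_Mapping.lookup Q (zmon n i j k l) - Poly_Mapping.lookup Q (zmon n i k j l) =
      3 * 2 * ((s i * t l - s l * t i) * (s j * t k - s k * t j))"
      using n dist by (simp add: lookups algebra_simps)
    then show ?thesis
      by (simp add: three)
  qed
qed

section \<open>The span of the rank 3 quadrics\<close>

text \<open>A variable that divides a product of variables is one of the factors and can be
  cancelled.\<close>

lemma var_add3_eq:
  assumes "var b + var c + var d = var j + var k + var l"
  shows "b = j \<and> var c + var d = var k + var l \<or> b = k \<and> var c + var d = var j + var l
    \<or> b = l \<and> var c + var d = var j + var k"
proof -
  have "Poly_Mapping.lookup (var j + var k + var l) b \<noteq> 0"
    unfolding assms[symmetric] by (simp add: lookup_add)
  then have "b = j \<or> b = k \<or> b = l"
    by (simp add: lookup_add split: if_splits)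
  then show ?thesis
  proof (elim disjE)
    assume x: "b = j"
    have "var b + (var c + var d) = var b + (var k + var l)"
      using assms unfolding x by (simp only: ac_simps)
    with x show ?thesis by simp
  next
    assume x: "b = k"
    have "var b + (var c + var d) = var b + (var j + var l)"
      using assms unfolding x by (simp only: ac_simps)
    with x show ?thesis by simp
  next
    assume x: "b = l"
    have "var b + (var c + var d) = var b + (var j + var k)"
      using assms unfolding x by (simp only: ac_simps)
    with x show ?thesis by simp
  qed
qed

lemma var_add4_eq:
  assumes "var a + var b + var c + var d = var i + var j + var k + var l"
  shows "a = i \<and> var b + var c + var d = var j + var k + var l
    \<or> a = j \<and> var b + var c + var d = var i + var k + var l
    \<or> a = k \<and> var b + var c + var d = var i + var j + var l
    \<or> a = l \<and> var b + var c + var d = var i + var j + var k"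
proof -
  have "Poly_Mapping.lookup (var i + var j + var k + var l) a \<noteq> 0"
    unfolding assms[symmetric] by (simp add: lookup_add)
  then have "a = i \<or> a = j \<or> a = k \<or> a = l"
    by (simp add: lookup_add split: if_splits)
  then show ?thesis
  proof (elim disjE)
    assume x: "a = i"
    have "var a + (var b + var c + var d) = var a + (var j + var k + var l)"
      using assms unfolding x by (simp only: ac_simps)
    with x show ?thesis by simp
  next
    assume x: "a = j"
    have "var a + (var b + var c + var d) = var a + (var i + var k + var l)"
      using assms unfolding x by (simp only: ac_simps)
    with x show ?thesis by simp
  next
    assume x: "a = k"
    have "var a + (var b + var c + var d) = var a + (var i + var j + var l)"
      using assms unfolding x by (simp only: ac_simps)
    with x show ?thesis by simp
  next
    assume x: "a = l"
    have "var a + (var b + var c + var d) = var a + (var i + var j + var k)"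
      using assms unfolding x by (simp only: ac_simps)
    with x show ?thesis by simp
  qed
qed

text \<open>Four factors, possibly repeated, can be split into two unordered pairs in at most three
  ways.\<close>

lemma zmon_eqI:
  assumes "var a + var b + var c + var d = var i + var j + var k + var l"
  shows "zmon n a b c d \<in> {zmon n i j k l, zmon n i k j l, zmon n i l j k}"
  apply (insert var_add4_eq[OF assms])
  by (elim disjE conjE; (drule var_add3_eq; (elim disjE conjE; (simp only: var_add_eq_iff;
        (elim disjE conjE; simp add: zmon_def pos_commute add.commute)))))

section \<open>Relations that follow from the generators\<close>

definition zvar :: "nat \<Rightarrow> nat \<Rightarrow> nat \<Rightarrow> 'a::field mpoly" where
  "zvar n i j = Poly_Mapping.single (var (pos n i j)) 1"

lemma zvar_commute: "zvar n i j = zvar n j i"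
  by (simp add: zvar_def pos_commute)

lemma zvar_mult: "zvar n i j * zvar n k l = Poly_Mapping.single (zmon n i j k l) 1"
  by (simp add: zvar_def zmon_def mult_single)

lemma linear_form_prod_form:
  assumes "Suc r = length (index_pairs n)" "i \<le> n" "j \<le> n" "k \<le> n" "l \<le> n"
  shows "linear_form r (prod_form n i k e j l h) = zvar n i j + pscale h (zvar n i l)
    + (pscale e (zvar n k j) + pscale (e * h) (zvar n k l))"
  unfolding prod_form_def linear_form_add linear_form_scale zvar_def
  using assms by (simp only: linear_form_delta pos_le)

text \<open>Isolates the linear algebra with the generators from the notion of rank;
  \<open>S\<close> will be the span of the rank 3 quadrics.\<close>

locale generators =
  fixes n r :: nat and S :: "'a::alg_closed_field mpoly set"
  assumes r: "Suc r = length (index_pairs n)"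
    and three: "(3::'a) = 0"
    and S: "pm.subspace S"
    and gen: "\<And>i j k l e h. i \<le> n \<Longrightarrow> j \<le> n \<Longrightarrow> k \<le> n \<Longrightarrow> l \<le> n \<Longrightarrow>
      i \<noteq> j \<Longrightarrow> i \<noteq> l \<Longrightarrow> k \<noteq> j \<Longrightarrow> k \<noteq> l \<Longrightarrow> k \<noteq> i \<or> e = 0 \<Longrightarrow> l \<noteq> j \<or> h = 0 \<Longrightarrow>
      gen r n i k e j l h \<in> S"
begin

abbreviation Z :: "nat \<Rightarrow> nat \<Rightarrow> 'a mpoly" where "Z \<equiv> zvar n"

lemma add_thrice: "p + p + p = (0 :: 'a mpoly)"
proof (rule poly_mapping_eqI)
  fix m
  have "Poly_Mapping.lookup (p + p + p) m = (1 + 1 + 1) * Poly_Mapping.lookup p m"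
    by (simp only: lookup_add distrib_right mult_1_left)
  also have "1 + 1 + 1 = (3::'a)" by simp
  finally show "Poly_Mapping.lookup (p + p + p) m = Poly_Mapping.lookup 0 m"
    by (simp only: three mult_zero_left lookup_zero)
qed

text \<open>The generator for \<open>s = x_i\<close>, \<open>t = x_j\<close>. The next two relations
  come from \<open>s = x_i + x_k\<close> with \<open>t = x_j\<close>, and with
  \<open>t = x_j + x_l\<close>.\<close>

lemma square_relation:
  assumes "i \<le> n" "j \<le> n" "i \<noteq> j"
  shows "Z i i * Z j j - Z i j * Z i j \<in> S"
  using gen[of i j i j 0 0] assms r by (simp add: gen_def conic_def linear_form_prod_form)

lemma sum_square_relation:
  assumes "i \<le> n" "j \<le> n" "k \<le> n" "distinct [i, j, k]"
  shows "(Z i i + Z i k + (Z k i + Z k k)) * Z j j - (Z i j + Z k j) * (Z i j + Z k j) \<in> S"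
  using gen[of i j k j 1 0] assms r by (simp add: gen_def conic_def linear_form_prod_form)

lemma sum_sum_relation:
  assumes "i \<le> n" "j \<le> n" "k \<le> n" "l \<le> n" "distinct [i, j, k, l]"
  shows "(Z i i + Z i k + (Z k i + Z k k)) * (Z j j + Z j l + (Z l j + Z l l)) -
    (Z i j + Z i l + (Z k j + Z k l)) * (Z i j + Z i l + (Z k j + Z k l)) \<in> S"
  using gen[of i j k l 1 1] assms r by (simp add: gen_def conic_def linear_form_prod_form)

text \<open>The part of the relation for \<open>s = x_i + x_k\<close>, \<open>t = x_j\<close> that
  is bilinear in \<open>x_i\<close> and \<open>x_k\<close> is twice the claimed element.\<close>

lemma polarized_relation:
  assumes "i \<le> n" "j \<le> n" "k \<le> n" "distinct [i, j, k]"
  shows "Z j j * Z i k - Z i j * Z j k \<in> S"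
proof -
  define Y where "Y = Z j j * Z i k - Z i j * Z j k"
  have "((Z i i + Z i k + (Z k i + Z k k)) * Z j j - (Z i j + Z k j) * (Z i j + Z k j))
    - (Z i i * Z j j - Z i j * Z i j) - (Z k k * Z j j - Z k j * Z k j) \<in> S"
    using assms by (intro pm.subspace_diff[OF S] sum_square_relation square_relation) auto
  also have "((Z i i + Z i k + (Z k i + Z k k)) * Z j j - (Z i j + Z k j) * (Z i j + Z k j))
    - (Z i i * Z j j - Z i j * Z i j) - (Z k k * Z j j - Z k j * Z k j) = Y + Y"
    unfolding Y_def zvar_commute[of n k i] zvar_commute[of n k j] by (simp add: algebra_simps)
  finally have YY: "Y + Y \<in> S" .
  \<comment> \<open>Doubling again replaces the division by 2, as \<open>4 = 1\<close> in
    characteristic 3.\<close>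
  have "(Y + Y) + (Y + Y) \<in> S"
    by (rule pm.subspace_add[OF S YY YY])
  also have "(Y + Y) + (Y + Y) = Y"
    using add_thrice[of Y] by (metis add.assoc add_0)
  finally show ?thesis
    by (simp add: Y_def)
qed

lemma repeated_relation:
  assumes "i \<le> n" "k \<le> n" "l \<le> n"
  shows "Z i i * Z k l - Z i k * Z i l \<in> S"
proof -
  consider "k = i" | "l = i" | "k = l" "k \<noteq> i" | "distinct [k, i, l]" by fastforce
  then show ?thesis
  proof cases
    case 1
    then show ?thesis by (simp add: pm.subspace_0[OF S])
  next
    case 2
    show ?thesis
      unfolding 2 zvar_commute[of n k i] by (simp add: mult.commute pm.subspace_0[OF S])
  next
    case 3
    then show ?thesis
      using square_relation[of i l] assms by simp
  next
    case 4
    then show ?thesis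
      using polarized_relation[of k i l] assms by (subst zvar_commute[of n i k]) simp
  qed
qed

lemma four_index_relation:
  assumes "i \<le> n" "j \<le> n" "k \<le> n" "l \<le> n" "distinct [i, j, k, l]"
  shows "Z i j * Z k l + Z i k * Z j l + Z i l * Z j k \<in> S"
proof -
  define A where "A = (Z i i + Z i k + (Z k i + Z k k)) * (Z j j + Z j l + (Z l j + Z l l)) -
    (Z i j + Z i l + (Z k j + Z k l)) * (Z i j + Z i l + (Z k j + Z k l))"
  define B where "B = (\<lambda>i j k. (Z i i + Z i k + (Z k i + Z k k)) * Z j j - (Z i j + Z k j) * (Z i j + Z k j))"
  define P where "P = (\<lambda>i j k. Z j j * Z i k - Z i j * Z j k)"
  define T where "T = Z i j * Z k l + Z i k * Z j l + Z i l * Z j k"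
  define U where "U = Z i k * Z j l - Z i j * Z k l - Z i l * Z j k"
  have "A \<in> S"
    unfolding A_def using assms by (intro sum_sum_relation)
  moreover have "B i j k \<in> S" "B i l k \<in> S"
    unfolding B_def using assms by (auto intro!: sum_square_relation)
  moreover have "P j i l \<in> S" "P j k l \<in> S"
    unfolding P_def using assms by (auto intro!: polarized_relation)
  \<comment> \<open>The terms \<open>B\<close> remove what is quadratic in \<open>x_j\<close> or in
    \<open>x_l\<close>, the terms \<open>P\<close> what is quadratic in \<open>x_i\<close> or in
    \<open>x_k\<close>. What remains is the full polarization
    \<open>4 z_ik z_jl - 2 z_ij z_kl - 2 z_il z_jk\<close>, written as \<open>T\<close> plus a
    threefold sum.\<close>
  ultimately have "A - B i j k - B i l k - (P j i l + P j i l) - (P j k l + P j k l) \<in> S"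
    by (intro pm.subspace_add[OF S] pm.subspace_diff[OF S])
  also have "A - B i j k - B i l k - (P j i l + P j i l) - (P j k l + P j k l) = T + (U + U + U)"
    unfolding A_def B_def P_def T_def U_def
      zvar_commute[of n k i] zvar_commute[of n k j] zvar_commute[of n l i] zvar_commute[of n l j]
      zvar_commute[of n l k] zvar_commute[of n j i]
    by (simp add: algebra_simps)
  finally have "T + (U + U + U) \<in> S" .
  then show ?thesis
    by (simp only: add_thrice T_def add_0_right)
qed

end

lemma card_4_sorted:
  fixes A :: "'a::linorder set"
  assumes "card A = 4"
  obtains i j k l where "i < j" "j < k" "k < l" "A = {i, j, k, l}"
proof -
  have fin: "finite A"
    using assms card.infinite by fastforce
  have "length (sorted_list_of_set A) = Suc (Suc (Suc (Suc 0)))"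
    using assms by simp
  then obtain i j k l where "sorted_list_of_set A = [i, j, k, l]"
    unfolding length_Suc_conv length_0_conv by blast
  then have "sorted_wrt (<) [i, j, k, l]" "A = set [i, j, k, l]"
    using strict_sorted_list_of_set[of A] set_sorted_list_of_set[OF fin] by simp_all
  then show ?thesis
    by (intro that) auto
qed

lemma zmon_neq:
  assumes "i \<le> n" "j \<le> n" "k \<le> n" "l \<le> n" "distinct [i, j, k, l]"
  shows "zmon n i j k l \<noteq> zmon n i k j l" "zmon n i j k l \<noteq> zmon n i l j k" "zmon n i k j l \<noteq> zmon n i l j k"
  using assms by (auto simp: zmon_def var_add_eq_iff pos_eq_iff)

context generators
begin

text \<open>Each weight component of \<open>Q\<close> lies in \<open>S\<close>. With a repeated
  index, all monomials of that weight agree modulo \<open>S\<close> and the coefficients add up to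
  0. With four different indices, the component is a multiple of
  \<open>four_index_relation\<close>.\<close>

lemma ideal2_subset:
  assumes Q: "Q \<in> ideal2 r (veronese_variety n)"
    and eq: "\<And>i j k l. i < j \<Longrightarrow> j < k \<Longrightarrow> k < l \<Longrightarrow> l \<le> n \<Longrightarrow>
      Poly_Mapping.lookup Q (zmon n i j k l) = Poly_Mapping.lookup Q (zmon n i k j l)"
  shows "Q \<in> S"
proof -
  have quad: "Q \<in> quadratic_forms r"
    using Q by (simp add: ideal2_veronese)
  let ?K = "Poly_Mapping.keys Q"
  let ?q = "Poly_Mapping.lookup Q"
  let ?s = "\<lambda>m c. Poly_Mapping.single m c :: 'a mpoly"
  have "Q = (\<Sum>m\<in>?K. ?s m (?q m))"
    by (rule sum_single_lookup[symmetric])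
  also have "\<dots> = (\<Sum>w\<in>weight n ` ?K. \<Sum>m | m \<in> ?K \<and> weight n m = w. ?s m (?q m))"
    by (rule sum.group[symmetric]) auto
  also have "\<dots> \<in> S"
  proof (rule pm.subspace_sum[OF S])
    fix w assume "w \<in> weight n ` ?K"
    then obtain m0 where m0: "m0 \<in> ?K" "w = weight n m0" by blast
    obtain a b c d where abcd: "a \<le> n" "b \<le> n" "c \<le> n" "d \<le> n" "m0 = zmon n a b c d"
      by (rule keys_quadratic_forms[OF r quad m0(1)])
    have w: "w = var a + var b + var c + var d"
      unfolding m0(2) abcd(5) by (rule weight_zmon[OF abcd(1-4)])
    \<comment> \<open>Stated for values of any type, since it is applied to the coefficients as well
      as to the terms of \<open>Q\<close>.\<close>
    have sum_class: "(\<Sum>m | m \<in> ?K \<and> weight n m = w. f m) =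
        (\<Sum>m\<in>{zmon n i j k l, zmon n i k j l, zmon n i l j k}. f m)"
      if n: "i \<le> n" "j \<le> n" "k \<le> n" "l \<le> n" and wt: "w = var i + var j + var k + var l"
        and f: "\<And>m. m \<notin> ?K \<Longrightarrow> f m = 0" for i j k l and f :: "monomial \<Rightarrow> 'x::comm_monoid_add"
    proof (rule sum.mono_neutral_left)
      show "{m. m \<in> ?K \<and> weight n m = w} \<subseteq> {zmon n i j k l, zmon n i k j l, zmon n i l j k}"
      proof
        fix m assume m: "m \<in> {m. m \<in> ?K \<and> weight n m = w}"
        then have "m \<in> ?K" by simp
        obtain a b c d where abcd: "a \<le> n" "b \<le> n" "c \<le> n" "d \<le> n" "m = zmon n a b c d"
          by (rule keys_quadratic_forms[OF r quad \<open>m \<in> ?K\<close>])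
        then have "var a + var b + var c + var d = var i + var j + var k + var l"
          using m wt by (simp add: weight_zmon)
        then show "m \<in> {zmon n i j k l, zmon n i k j l, zmon n i l j k}"
          unfolding abcd(5) by (rule zmon_eqI)
      qed
      have "weight n m = w" if "m \<in> {zmon n i j k l, zmon n i k j l, zmon n i l j k}" for m
        using that n by (auto simp: weight_zmon wt ac_simps)
      then show "\<forall>m\<in>{zmon n i j k l, zmon n i k j l, zmon n i l j k} -
          {m. m \<in> ?K \<and> weight n m = w}. f m = 0"
        using f by auto
    qed simp
    have sum0: "(\<Sum>m | m \<in> ?K \<and> weight n m = w. ?q m) = 0"
      by (rule ideal2_weight_sum[OF r Q])
    show "(\<Sum>m | m \<in> ?K \<and> weight n m = w. ?s m (?q m)) \<in> S"
    proof (cases "distinct [a, b, c, d]")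
      case True
      then have "card {a, b, c, d} = 4" by simp
      then obtain i j k l where less: "i < j" "j < k" "k < l" and ijkl: "{a, b, c, d} = {i, j, k, l}"
        by (rule card_4_sorted)
      have n: "i \<le> n" "j \<le> n" "k \<le> n" "l \<le> n"
      proof -
        have "{i, j, k, l} \<subseteq> {..n}"
          unfolding ijkl[symmetric] using abcd(1-4) by simp
        then show "i \<le> n" "j \<le> n" "k \<le> n" "l \<le> n" by auto
      qed
      have "w = (\<Sum>x\<in>{a, b, c, d}. var x)"
        unfolding w using True by (simp add: add.assoc)
      also have "\<dots> = var i + var j + var k + var l"
        unfolding ijkl using less by (simp add: add.assoc)
      finally have wt: "w = var i + var j + var k + var l" .
      have "distinct [i, j, k, l]"
        using less by auto
      note neq = zmon_neq[OF n this]
      let ?c = "?q (zmon n i j k l)"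
      have c2: "?q (zmon n i k j l) = ?c"
        by (rule eq[OF less n(4), symmetric])
      have "?c + (?c + ?q (zmon n i l j k)) = 0"
        using sum0 sum_class[OF n wt, of ?q] neq by (simp add: in_keys_iff c2)
      \<comment> \<open>Since \<open>3 = 0\<close>, the third coefficient is forced to equal the
        other two.\<close>
      moreover have "?c + ?c + ?c = 3 * ?c"
        by simp
      ultimately have c3: "?q (zmon n i l j k) = ?c"
        unfolding three by (metis add.assoc add_left_imp_eq mult_zero_left)
      have "(\<Sum>m | m \<in> ?K \<and> weight n m = w. ?s m (?q m)) =
        (\<Sum>m\<in>{zmon n i j k l, zmon n i k j l, zmon n i l j k}. ?s m (?q m))"
        by (rule sum_class[OF n wt]) (simp add: in_keys_iff)
      also have "\<dots> = pscale ?c (zvar n i j * zvar n k l + zvar n i k * zvar n j l + zvar n i l * zvar n j k)"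
        unfolding zvar_mult using neq
        by (intro poly_mapping_eqI) (simp add: lookup_add lookup_single when_def c2 c3)
      also have "\<dots> \<in> S"
        using less n by (intro pm.subspace_scale[OF S] four_index_relation) auto
      finally show ?thesis .
    next
      case False
      have "\<exists>i k l. i \<le> n \<and> k \<le> n \<and> l \<le> n \<and> w = var i + var i + var k + var l"
      proof -
        consider "a = b" | "a = c" | "a = d" | "b = c" | "b = d" | "c = d"
          using False by auto
        then show ?thesis
        proof cases
          case 1
          then show ?thesis
            using abcd(1-4) by (intro exI[of _ a] exI[of _ c] exI[of _ d]) (simp add: w ac_simps)
        next
          case 2
          then show ?thesis
            using abcd(1-4) by (intro exI[of _ a] exI[of _ b] exI[of _ d]) (simp add: w ac_simps)
        next
          case 3
          then show ?thesis
            using abcd(1-4) by (intro exI[of _ a] exI[of _ b] exI[of _ c]) (simp add: w ac_simps)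
        next
          case 4
          then show ?thesis
            using abcd(1-4) by (intro exI[of _ b] exI[of _ a] exI[of _ d]) (simp add: w ac_simps)
        next
          case 5
          then show ?thesis
            using abcd(1-4) by (intro exI[of _ b] exI[of _ a] exI[of _ c]) (simp add: w ac_simps)
        next
          case 6
          then show ?thesis
            using abcd(1-4) by (intro exI[of _ c] exI[of _ a] exI[of _ b]) (simp add: w ac_simps)
        qed
      qed
      then obtain i k l where n: "i \<le> n" "i \<le> n" "k \<le> n" "l \<le> n"
        and wt: "w = var i + var i + var k + var l"
        by blast
      let ?M = "{zmon n i i k l, zmon n i k i l, zmon n i l i k}"
      have rel: "?s m 1 - ?s (zmon n i i k l) 1 \<in> S" if "m \<in> ?M" for m
      proof -
        have "zmon n i l i k = zmon n i k i l"
          by (simp add: zmon_def add.commute)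
        then have "?s (zmon n i i k l) 1 - ?s m 1 \<in> S"
          using that repeated_relation[OF n(1,3,4)] pm.subspace_0[OF S] by (auto simp: zvar_mult)
        then have "- (?s (zmon n i i k l) 1 - ?s m 1) \<in> S"
          by (rule pm.subspace_neg[OF S])
        then show ?thesis by simp
      qed
      have "(\<Sum>m\<in>?M. ?q m) = 0"
        using sum0 sum_class[OF n wt, of ?q] by (simp add: in_keys_iff)
      then have "pscale (\<Sum>m\<in>?M. ?q m) (?s (zmon n i i k l) 1) = 0"
        by simp
      \<comment> \<open>The subtracted sum is 0; it allows every monomial to be paired with the same
        fixed one.\<close>
      then have "(\<Sum>m\<in>?M. ?s m (?q m)) =
          (\<Sum>m\<in>?M. ?s m (?q m)) - (\<Sum>m\<in>?M. pscale (?q m) (?s (zmon n i i k l) 1))"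
        by (simp only: pm.scale_sum_left diff_zero)
      also have "\<dots> = (\<Sum>m\<in>?M. pscale (?q m) (?s m 1 - ?s (zmon n i i k l) 1))"
        unfolding sum_subtractf[symmetric]
        by (intro sum.cong refl poly_mapping_eqI) (simp add: lookup_minus lookup_single when_def right_diff_distrib)
      also have "\<dots> \<in> S"
        using rel by (intro pm.subspace_sum[OF S] pm.subspace_scale[OF S])
      finally show ?thesis
        using sum_class[OF n wt, of "\<lambda>m. ?s m (?q m)"] by (simp add: in_keys_iff)
    qed
  qed
  finally show ?thesis .
qed

end

section \<open>The codimension\<close>

text \<open>Provides the finite spanning set that the dimension count requires.\<close>

lemma quadratic_forms_span:
  "quadratic_forms r \<subseteq> pm.span ((\<lambda>(p, q). Poly_Mapping.single (var p + var q) 1) ` ({..r} \<times> {..r}))"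
proof
  fix Q :: "'a::field mpoly" assume Q: "Q \<in> quadratic_forms r"
  let ?F = "(\<lambda>(p, q). Poly_Mapping.single (var p + var q) 1) ` ({..r} \<times> {..r}) :: 'a mpoly set"
  have "Q = (\<Sum>m\<in>Poly_Mapping.keys Q. pscale (Poly_Mapping.lookup Q m) (Poly_Mapping.single m 1))"
    unfolding pscale_single by (simp add: sum_single_lookup)
  also have "\<dots> \<in> pm.span ?F"
  proof (intro pm.span_sum pm.span_scale pm.span_base)
    fix m assume m: "m \<in> Poly_Mapping.keys Q"
    obtain p q where "p \<le> r" "q \<le> r" "m = var p + var q"
      by (rule quadratic_formsE[OF Q m])
    then show "Poly_Mapping.single m 1 \<in> ?F"
      by (intro image_eqI[of _ _ "(p, q)"]) auto
  qed
  finally show "Q \<in> pm.span ?F" .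
qed

lemma eval_poly_diff: "eval_poly (p - q) z = eval_poly p z - eval_poly q z"
proof -
  let ?S = "Poly_Mapping.keys p \<union> Poly_Mapping.keys q"
  have ev: "eval_poly p' z = (\<Sum>m\<in>?S. Poly_Mapping.lookup p' m * mon_eval m (Poly_Mapping.lookup z))"
    if "Poly_Mapping.keys p' \<subseteq> ?S" for p'
    unfolding eval_poly_mon_eval using that by (intro sum.mono_neutral_left) (auto simp: in_keys_iff)
  have "Poly_Mapping.keys (p - q) \<subseteq> ?S"
    by (auto simp: in_keys_iff lookup_minus)
  then show ?thesis
    by (simp add: ev lookup_minus left_diff_distrib sum_subtractf)
qed

lemma eval_poly_single: "eval_poly (Poly_Mapping.single m 1) z = mon_eval m (Poly_Mapping.lookup z)"
  by (simp add: eval_poly_mon_eval)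

text \<open>Both monomials induce the same product \<open>x_i x_j x_k x_l\<close>.\<close>

lemma zmon_diff_ideal2:
  assumes r: "Suc r = length (index_pairs n)" and n: "i \<le> n" "j \<le> n" "k \<le> n" "l \<le> n"
  shows "Poly_Mapping.single (zmon n i j k l) 1 - Poly_Mapping.single (zmon n i k j l) 1
    \<in> ideal2 r (veronese_variety n)"
proof -
  have "Poly_Mapping.single (zmon n i j k l) 1 - Poly_Mapping.single (zmon n i k j l) 1 \<in> quadratic_forms r"
    unfolding zmon_def using pos_le[OF r] n
    by (intro pm.subspace_diff[OF subspace_quadratic_forms] single_quadratic_forms) auto
  moreover have "var i + var j + var k + var l = var i + var k + var j + var l"
    by (simp add: ac_simps)
  ultimately show ?thesis
    using n by (simp add: ideal2_veronese eval_poly_diff eval_poly_single mon_eval_zmon)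
qed

theorem theorem1p3:
  fixes n r :: nat and X :: "(nat \<Rightarrow>\<^sub>0 'a::alg_closed_field) set set"
  assumes "CHAR('a) = 3"
    and "n \<ge> 3"
    and "r = ((n + 2) choose 2) - 1"
    and "X = veronese_variety n"
  shows "proj_codim (proj_span (rank_quadrics 3 r X)) (proj (ideal2 r X)) = int ((n + 1) choose 4)"
proof -
  have three: "(3::'a) = 0"
    using of_nat_CHAR[where 'a = 'a] by (simp add: assms(1))
  have "(3::'a) = 2 + 1" by simp
  with three have two: "(2::'a) \<noteq> 0"
    by (metis add_0 zero_neq_one)
  \<comment> \<open>Ensures that the truncated subtraction in \<open>r\<close> is exact.\<close>
  have "(n + 2) choose 2 > 0"
    by (simp add: zero_less_binomial_iff)
  then have r: "Suc r = length (index_pairs n)"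
    using assms(3) by (simp add: length_index_pairs)
  define I :: "'a mpoly set" where "I = ideal2 r X"
  define W :: "'a mpoly set" where "W = pm.span (\<Union> (rank_quadrics 3 r X))"
  define T where "T = {A. A \<subseteq> {..n} \<and> card A = 4}"
  define i j k l where "i = (\<lambda>A::nat set. sorted_list_of_set A ! 0)"
    and "j = (\<lambda>A::nat set. sorted_list_of_set A ! 1)"
    and "k = (\<lambda>A::nat set. sorted_list_of_set A ! 2)"
    and "l = (\<lambda>A::nat set. sorted_list_of_set A ! 3)"
  have ijkl_eq: "i {a, b, c, d} = a" "j {a, b, c, d} = b" "k {a, b, c, d} = c" "l {a, b, c, d} = d"
    if "a < b" "b < c" "c < d" for a b c d
  proof -
    have "sorted_list_of_set {a, b, c, d} = [a, b, c, d]"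
      using that by (intro sorted_list_of_set_unique[THEN iffD1]) auto
    then show "i {a, b, c, d} = a" "j {a, b, c, d} = b" "k {a, b, c, d} = c" "l {a, b, c, d} = d"
      by (simp_all add: i_def j_def k_def l_def numeral_2_eq_2 numeral_3_eq_3)
  qed
  have ijkl: "i A < j A \<and> j A < k A \<and> k A < l A \<and> A = {i A, j A, k A, l A}" if "A \<in> T" for A
  proof -
    obtain a b c d where less: "a < b" "b < c" "c < d" and A: "A = {a, b, c, d}"
      using card_4_sorted[of A] \<open>A \<in> T\<close> unfolding T_def by blast
    show ?thesis
      unfolding A ijkl_eq[OF less] using less by simp
  qed
  have n: "i A \<le> n" "j A \<le> n" "k A \<le> n" "l A \<le> n" if "A \<in> T" for A
  proof -
    have "{i A, j A, k A, l A} \<subseteq> {..n}"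
      using that ijkl[OF that] by (simp add: T_def)
    then show "i A \<le> n" "j A \<le> n" "k A \<le> n" "l A \<le> n" by auto
  qed
  \<comment> \<open>For each set of four indices, \<open>phi A\<close> compares the coefficients of
    \<open>z_ij z_kl\<close> and \<open>z_ik z_jl\<close>, and \<open>E A\<close> is the difference
    of these two monomials.\<close>
  define M where "M = (\<lambda>A. zmon n (i A) (j A) (k A) (l A))"
  define M' where "M' = (\<lambda>A. zmon n (i A) (k A) (j A) (l A))"
  define E where "E = (\<lambda>A. Poly_Mapping.single (M A) 1 - Poly_Mapping.single (M' A) (1::'a))"
  define phi where "phi = (\<lambda>A Q. Poly_Mapping.lookup Q (M A) - Poly_Mapping.lookup Q (M' A) :: 'a)"
  have phi_add: "phi A (P + Q) = phi A P + phi A Q" and phi_scale: "phi A (pscale c Q) = c * phi A Q" for A c P Q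
    by (simp_all add: phi_def lookup_add right_diff_distrib)
  have wt: "weight n (M A) = (\<Sum>x\<in>A. var x)" "weight n (M' A) = (\<Sum>x\<in>A. var x)" if A: "A \<in> T" for A
  proof -
    have less: "i A < j A" "j A < k A" "k A < l A"
      using ijkl[OF A] by auto
    have "(\<Sum>x\<in>A. var x) = (\<Sum>x\<in>{i A, j A, k A, l A}. var x)"
      using ijkl[OF A] by simp
    also have "\<dots> = var (i A) + var (j A) + var (k A) + var (l A)"
      using less by (simp add: add.assoc)
    finally show "weight n (M A) = (\<Sum>x\<in>A. var x)" "weight n (M' A) = (\<Sum>x\<in>A. var x)"
      unfolding M_def M'_def using n[OF A] by (simp_all add: weight_zmon ac_simps)
  qed
  \<comment> \<open>The weight determines the set of indices, so different sets involve different
    monomials.\<close>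
  have inj: "A = B" if "A \<in> T" "B \<in> T" "(\<Sum>x\<in>A. var x) = (\<Sum>x\<in>B. var x)" for A B
  proof -
    have "x \<in> C \<longleftrightarrow> Poly_Mapping.lookup (\<Sum>x\<in>C. var x) x \<noteq> 0" if "C \<in> T" for C x
    proof -
      have "finite C"
        using that finite_subset[of C "{..n}"] by (simp add: T_def)
      then show ?thesis
        by (auto simp: lookup_sum_pm)
    qed
    then show ?thesis
      using that by (metis subsetI subset_antisym)
  qed
  have dual: "phi A (E B) = 0 \<longleftrightarrow> A \<noteq> B" if AB: "A \<in> T" "B \<in> T" for A B
  proof (cases "A = B")
    case True
    have "M A \<noteq> M' A"
      unfolding M_def M'_def using n[OF AB(1)] ijkl[OF AB(1)] by (intro zmon_neq) auto
    then have "phi A (E A) = 2"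
      by (simp add: phi_def E_def lookup_minus lookup_single when_def)
    with True two show ?thesis by simp
  next
    case False
    then have "(\<Sum>x\<in>A. var x) \<noteq> (\<Sum>x\<in>B. var x)"
      using inj[OF AB] by blast
    then have "M A \<noteq> M B" "M A \<noteq> M' B" "M' A \<noteq> M B" "M' A \<noteq> M' B"
      using wt[OF AB(1)] wt[OF AB(2)] by metis+
    with False show ?thesis
      by (auto simp: phi_def E_def lookup_minus lookup_single when_def)
  qed
  have E: "E A \<in> I" if "A \<in> T" for A
    unfolding E_def M_def M'_def I_def assms(4) by (rule zmon_diff_ideal2[OF r n[OF that]])
  have subI: "pm.subspace I"
    unfolding I_def by (rule subspace_ideal2)
  have subW: "pm.subspace W"
    unfolding W_def by (rule pm.subspace_span)
  \<comment> \<open>The span is the common kernel of the functionals: rank 3 quadrics satisfy these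
    equations, and the generators yield every solution.\<close>
  have W: "W = {Q \<in> I. \<forall>A\<in>T. phi A Q = 0}"
  proof
    have "pm.subspace {Q \<in> I. \<forall>A\<in>T. phi A Q = 0}"
      using subI unfolding pm.subspace_def by (auto simp: phi_add phi_scale) (simp add: phi_def)
    moreover have "\<Union> (rank_quadrics 3 r X) \<subseteq> {Q \<in> I. \<forall>A\<in>T. phi A Q = 0}"
    proof
      fix P assume "P \<in> \<Union> (rank_quadrics 3 r X)"
      then obtain L Q where L: "L \<in> proj I" "L = pm.span {Q}" "quadric_rank r Q = 3" "P \<in> L"
        unfolding rank_quadrics_def I_def by blast
      then have Q: "Q \<in> I"
        using pm.span_base[of Q "{Q}"] by (auto simp: proj_def)
      have "phi A Q = 0" if "A \<in> T" for A
        using rank_3_lookup_eq[OF r _ L(3) two three n[OF that]] Q ijkl[OF that]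
        unfolding I_def assms(4) by (simp add: phi_def M_def M'_def)
      moreover obtain c where "P = pscale c Q"
        using L(2,4) by (auto simp: pm.span_singleton)
      ultimately show "P \<in> {Q \<in> I. \<forall>A\<in>T. phi A Q = 0}"
        using Q pm.subspace_scale[OF subI] by (simp add: phi_scale)
    qed
    ultimately show "W \<subseteq> {Q \<in> I. \<forall>A\<in>T. phi A Q = 0}"
      unfolding W_def by (intro pm.span_minimal)
  next
    interpret generators n r W
    proof
      fix i j k l and e h :: 'a
      assume *: "i \<le> n" "j \<le> n" "k \<le> n" "l \<le> n" "i \<noteq> j" "i \<noteq> l" "k \<noteq> j" "k \<noteq> l"
        "k \<noteq> i \<or> e = 0" "l \<noteq> j \<or> h = 0"
      have "gen r n i k e j l h \<in> \<Union> (rank_quadrics 3 r X)"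
        using gen_ideal2[OF r *(1-4) two] quadric_rank_gen[OF r *(1-4) two *(5-10)]
        unfolding assms(4) by (rule rank_quadricsI) simp
      then show "gen r n i k e j l h \<in> W"
        unfolding W_def by (rule pm.span_base)
    qed (fact r three subW)+
    show "{Q \<in> I. \<forall>A\<in>T. phi A Q = 0} \<subseteq> W"
    proof
      fix Q assume Q: "Q \<in> {Q \<in> I. \<forall>A\<in>T. phi A Q = 0}"
      show "Q \<in> W"
      proof (rule ideal2_subset)
        show "Q \<in> ideal2 r (veronese_variety n)"
          using Q by (simp add: I_def assms(4))
        fix a b c d assume less: "a < b" "b < c" "c < d" "d \<le> n"
        define A where "A = {a, b, c, d}"
        have A: "A \<in> T"
          using less by (simp add: A_def T_def)
        have "i A = a" "j A = b" "k A = c" "l A = d"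
          unfolding A_def using ijkl_eq[OF less(1-3)] by simp_all
        then show "Poly_Mapping.lookup Q (zmon n a b c d) = Poly_Mapping.lookup Q (zmon n a c b d)"
          using Q A by (auto simp: phi_def M_def M'_def)
      qed
    qed
  qed

  \<comment> \<open>Counting dimensions\<close>
  have "pm.dim I = pm.dim W + card T"
    unfolding W
  proof (rule dim_common_kernel[where E = E and phi = phi, OF _ subI])
    show "I \<subseteq> pm.span ((\<lambda>(p, q). Poly_Mapping.single (var p + var q) 1) ` ({..r} \<times> {..r}))"
      using quadratic_forms_span[of r] by (auto simp: I_def ideal2_def)
    show "finite T"
      by (rule finite_subset[of _ "Pow {..n}"]) (auto simp: T_def)
  qed (simp_all add: phi_add phi_scale E dual)
  moreover have "card T = (n + 1) choose 4"
    unfolding T_def using n_subsets[of "{..n}" 4] by simp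
  moreover have "proj_codim (proj_span (rank_quadrics 3 r X)) (proj (ideal2 r X)) =
    int (pm.dim I) - int (pm.dim W)"
    unfolding proj_span_def W_def[symmetric] I_def[symmetric] by (rule proj_codim_proj[OF subW subI])
  ultimately show ?thesis
    by simp
qed

end
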